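(* The following decision problem $UI_2$ is NP-hard (in the sense that a polynomial-time algorithm for it would imply $\mathrm{P}=\mathrm{NP}$). Input: a finite simple graph $G$ with nonnegative integer vertex weights. Question: does $G$ have a unique maximum weight independent set, i.e., exactly one independent set whose weight equals the maximum weight of an independent set of $G$?
   Context: The weight of a vertex set is the sum of the weights of its vertices; an independent set is a set of pairwise nonadjacent vertices. *)

theory Defs
  imports "HOL-Computational_Algebra.Polynomial"
begin

datatype symbol = Blank | Bit bool | Aux nat

datatype move = MoveLeft | Stay | MoveRight

fun offset :: "move \<Rightarrow> int" where
  "offset MoveLeft = -1"
| "offset Stay = 0"
| "offset MoveRight = 1"

text \<open>
  The tapes are infinite in both directions; the second component is the head position.
\<close>
type_synonym tape = "(int \<Rightarrow> symbol) \<times> int"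

type_synonym config = "nat \<times> tape list"

text \<open>
  A transition \<open>((q, ss), (q', as))\<close> may be taken in state \<open>q\<close> when the heads read
  the symbols \<open>ss\<close>; it changes to state \<open>q'\<close> and performs on each tape the corresponding
  write and move from \<open>as\<close>.  The transition relation is required to be finite, hence only
  finitely many states and symbols are involved.  In general it is nondeterministic.
\<close>
record machine =
  tapes :: nat
  trans :: "((nat \<times> symbol list) \<times> (nat \<times> (symbol \<times> move) list)) set"
  start :: nat
  accept :: nat

definition wf_machine :: "machine \<Rightarrow> bool" where
  "wf_machine M \<longleftrightarrow> tapes M \<ge> 1 \<and> finite (trans M) \<and>
     (\<forall>((q, ss), (q', as)) \<in> trans M. length ss = tapes M \<and> length as = tapes M)"

definition deterministic :: "machine \<Rightarrow> bool" where
  "deterministic M \<longleftrightarrow> single_valued (trans M)"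

definition read :: "tape \<Rightarrow> symbol" where
  "read t = fst t (snd t)"

definition act :: "symbol \<times> move \<Rightarrow> tape \<Rightarrow> tape" where
  "act a t = ((fst t)(snd t := fst a), snd t + offset (snd a))"

definition step :: "machine \<Rightarrow> config \<Rightarrow> config \<Rightarrow> bool" where
  "step M c c' \<longleftrightarrow> (\<exists>as. ((fst c, map read (snd c)), (fst c', as)) \<in> trans M \<and>
                         snd c' = map2 act as (snd c))"

definition input_tape :: "bool list \<Rightarrow> tape" where
  "input_tape x =
     (\<lambda>i. if 0 \<le> i \<and> i < int (length x) then Bit (x ! nat i) else Blank, 0)"

definition blank_tape :: tape where
  "blank_tape = (\<lambda>_. Blank, 0)"

definition initial :: "machine \<Rightarrow> bool list \<Rightarrow> config" where
  "initial M x = (start M, input_tape x # replicate (tapes M - 1) blank_tape)"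

definition halted :: "machine \<Rightarrow> config \<Rightarrow> bool" where
  "halted M c \<longleftrightarrow> (\<nexists>c'. step M c c')"

text \<open>
  Acceptance means that some computation halts in the accepting state; halting in any
  other state is rejection.
\<close>
definition accepts :: "machine \<Rightarrow> bool list \<Rightarrow> bool" where
  "accepts M x \<longleftrightarrow> (\<exists>c. (step M)\<^sup>*\<^sup>* (initial M x) c \<and> halted M c \<and> fst c = accept M)"

text \<open>
  The time bound applies to every computation, accepting or not: on an input of length
  \<open>n\<close> no computation has more than \<open>T n\<close> steps.
\<close>
definition decides_in_time ::
    "machine \<Rightarrow> (nat \<Rightarrow> nat) \<Rightarrow> bool list set \<Rightarrow> bool" where
  "decides_in_time M T L \<longleftrightarrow>
     (\<forall>x. (\<forall>m c. (step M ^^ m) (initial M x) c \<longrightarrow> m \<le> T (length x)) \<and>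
          (x \<in> L \<longleftrightarrow> accepts M x))"

definition class_P :: "bool list set set" where
  "class_P = {L. \<exists>M (p :: nat poly).
     wf_machine M \<and> deterministic M \<and> decides_in_time M (poly p) L}"

definition class_NP :: "bool list set set" where
  "class_NP = {L. \<exists>M (p :: nat poly). wf_machine M \<and> decides_in_time M (poly p) L}"

definition simple_graph :: "'a set \<Rightarrow> 'a set set \<Rightarrow> bool" where
  "simple_graph V E \<longleftrightarrow> finite V \<and> E \<subseteq> {e. e \<subseteq> V \<and> card e = 2}"

definition independent_set :: "'a set \<Rightarrow> 'a set set \<Rightarrow> 'a set \<Rightarrow> bool" where
  "independent_set V E S \<longleftrightarrow> S \<subseteq> V \<and> pairwise (\<lambda>u v. {u, v} \<notin> E) S"

definition weight :: "('a \<Rightarrow> nat) \<Rightarrow> 'a set \<Rightarrow> nat" where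
  "weight w S = (\<Sum>v\<in>S. w v)"

definition max_independent_weight :: "'a set \<Rightarrow> 'a set set \<Rightarrow> ('a \<Rightarrow> nat) \<Rightarrow> nat" where
  "max_independent_weight V E w = Max (weight w ` {S. independent_set V E S})"

definition has_unique_mwis :: "'a set \<Rightarrow> 'a set set \<Rightarrow> ('a \<Rightarrow> nat) \<Rightarrow> bool" where
  "has_unique_mwis V E w \<longleftrightarrow>
     (\<exists>!S. independent_set V E S \<and> weight w S = max_independent_weight V E w)"

text \<open>
  Binary representation, least significant bit first.
\<close>
fun binary :: "nat \<Rightarrow> bool list" where
  "binary n = (if n = 0 then [] else odd n # binary (n div 2))"

declare binary.simps [simp del]

text \<open>
  Each binary digit is preceded by \<open>True\<close> and the number is terminated by \<open>False\<close>, so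
  that numbers can be concatenated without ambiguity.
\<close>
definition encode_nat :: "nat \<Rightarrow> bool list" where
  "encode_nat n = concat (map (\<lambda>b. [True, b]) (binary n)) @ [False]"

text \<open>
  A weighted graph on the vertices \<open>0, \<dots>, n - 1\<close> is encoded by \<open>n\<close> in unary, the weights
  in binary, and the adjacency matrix row by row.
\<close>
definition encode_graph :: "nat \<Rightarrow> nat set set \<Rightarrow> (nat \<Rightarrow> nat) \<Rightarrow> bool list" where
  "encode_graph n E w =
     replicate n True @ [False] @
     concat (map (\<lambda>v. encode_nat (w v)) [0..<n]) @
     map (\<lambda>(u, v). {u, v} \<in> E) (List.product [0..<n] [0..<n])"

lemma encode_nat_inj:
  assumes "encode_nat m @ xs = encode_nat n @ ys"
  shows "m = n \<and> xs = ys"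
  using assms
proof (induction m arbitrary: n rule: less_induct)
  case (less m)
  have zero: "encode_nat 0 = [False]"
    by (simp add: encode_nat_def binary.simps[of 0])
  have pos: "encode_nat k = True # odd k # encode_nat (k div 2)" if "k > 0" for k
    using that unfolding encode_nat_def binary.simps[of k] by simp
  show ?case
  proof (cases "m = 0 \<or> n = 0")
    case True
    then show ?thesis
      using less.prems pos[of m] pos[of n] by (cases "m = 0"; cases "n = 0") (auto simp: zero)
  next
    case False
    then have "odd m = odd n" "encode_nat (m div 2) @ xs = encode_nat (n div 2) @ ys"
      using less.prems pos[of m] pos[of n] by simp_all
    moreover from this(2) have "m div 2 = n div 2 \<and> xs = ys"
      using less.IH[of "m div 2" "n div 2"] False by simp
    ultimately show ?thesis
      by (metis even_two_times_div_two odd_two_times_div_two_succ)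
  qed
qed

lemma encode_nats_inj:
  assumes "concat (map (\<lambda>v. encode_nat (w v)) vs) @ xs =
           concat (map (\<lambda>v. encode_nat (w' v)) vs) @ ys"
  shows "(\<forall>v\<in>set vs. w v = w' v) \<and> xs = ys"
  using assms
proof (induction vs)
  case Nil
  then show ?case by simp
next
  case (Cons v vs)
  then have "encode_nat (w v) @ concat (map (\<lambda>v. encode_nat (w v)) vs) @ xs =
             encode_nat (w' v) @ concat (map (\<lambda>v. encode_nat (w' v)) vs) @ ys"
    by (simp only: list.map concat.simps append_assoc)
  then have "w v = w' v" and
    "concat (map (\<lambda>v. encode_nat (w v)) vs) @ xs = concat (map (\<lambda>v. encode_nat (w' v)) vs) @ ys"
    by (blast dest: encode_nat_inj)+
  with Cons.IH[OF this(2)] show ?case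
    by (metis set_ConsD)
qed

lemma encode_graph_inj:
  assumes "encode_graph n E w = encode_graph n' E' w'"
    and "simple_graph {..<n} E" "simple_graph {..<n'} E'"
  shows "n = n' \<and> E = E' \<and> (\<forall>v<n. w v = w' v)"
proof -
  have unary: "k = l \<and> xs = ys"
    if "replicate k True @ False # xs = replicate l True @ False # ys" for k l xs ys
    using that
  proof (induction k arbitrary: l)
    case 0
    then show ?case by (cases l) auto
  next
    case (Suc k)
    then show ?case by (cases l) auto
  qed
  have n: "n = n'"
    using unary[OF assms(1)[unfolded encode_graph_def append_Cons append_Nil]] by (rule conjunct1)
  have "concat (map (\<lambda>v. encode_nat (w v)) [0..<n]) @
          map (\<lambda>(u, v). {u, v} \<in> E) (List.product [0..<n] [0..<n]) =
        concat (map (\<lambda>v. encode_nat (w' v)) [0..<n]) @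
          map (\<lambda>(u, v). {u, v} \<in> E') (List.product [0..<n] [0..<n])"
    using assms(1) by (simp add: encode_graph_def n)
  from encode_nats_inj[OF this] have w: "\<forall>v<n. w v = w' v"
    and E: "\<And>u v. u < n \<Longrightarrow> v < n \<Longrightarrow> {u, v} \<in> E \<longleftrightarrow> {u, v} \<in> E'"
    by auto
  have "e \<in> E \<longleftrightarrow> e \<in> E'" for e
  proof -
    have "\<exists>u v. e = {u, v} \<and> u < n \<and> v < n" if "e \<in> E \<or> e \<in> E'"
    proof -
      have "e \<subseteq> {..<n}" "card e = 2"
        using that assms(2,3) n by (auto simp: simple_graph_def)
      then show ?thesis by (auto simp: card_2_iff)
    qed
    then show ?thesis using E by blast
  qed
  then show ?thesis using n w by blast
qed

text \<open>
  Strings that do not encode a weighted graph count as no-instances.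
\<close>
definition UI2 :: "bool list set" where
  "UI2 = {encode_graph n E w | n E w.
            simple_graph {..<n} E \<and> has_unique_mwis {..<n} E w}"

end

theory Submission
  imports Defs
begin

text \<open>
  Given a nondeterministic machine \<open>M\<close> with polynomial time bound, an accepting computation on \<open>x\<close> is
  described by a table of cells \<open>(t, i)\<close> for time \<open>t\<close> and tape position \<open>i\<close>.  The graph has one
  vertex for every cell and every possible entry of it, adjacent if the two entries contradict each other,
  and one further vertex \<open>z\<close> per cell, adjacent to all entries of all cells.  With weights 0 for the entries
  violating the initial or final condition and 1 otherwise, the vertices \<open>z\<close> form an independent set whose
  weight is the number of cells; nothing is heavier, and another set is equally heavy iff it is an
  accepting table.  So the maximum is unique iff \<open>M\<close> rejects.

  That the graph can be written down in polynomial time is shown by a program in a small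
  language; its continuations, finite in number, serve as the states of a Turing machine.
\<close>

section \<open>Machines with structured control\<close>

text \<open>Uniqueness of the maximum corresponds to rejection, so the construction maps the
  complement of an NP language to \<open>UI2\<close>; this suffices because the answer of a
  deterministic machine with a time bound can be negated. Both classes are defined by machines, so a
  computation itself is encoded rather than an intermediate complete problem.

  Only the weights depend on the bits of the input; the edges depend on its length alone. The
  possible entries of a cell form a finite set fixed by \<open>M\<close>, so their list is a
  constant of the program, and only pairs of cells are enumerated at run time. The program does no
  arithmetic: loop variables are head positions, and so are their differences, of which it matters
  only whether they are -1, 0, 1 or something else.

  This also explains the size of the table. \<open>T = (n + b) ^ c\<close> exceeds the running time
  and is the number of rounds of \<open>c\<close> nested loops over blocks of length
  \<open>n + b\<close>. In fewer than \<open>T\<close> steps a head may go either way, which asks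
  for \<open>2 * T\<close> columns; a square table lets the same length serve for all loops.\<close>

type_synonym store = "nat \<Rightarrow> tape"
text \<open>\<open>None\<close> keeps the symbol under the head, so that an effect can leave tapes
  alone without knowing what they contain.\<close>

type_synonym effect = "nat \<Rightarrow> symbol option \<times> move"

definition upd :: "symbol option \<times> move \<Rightarrow> tape \<Rightarrow> tape" where
  "upd a t = act (case fst a of None \<Rightarrow> read t | Some s \<Rightarrow> s, snd a) t"

lemma upd_None [simp]: "upd (None, m) t = (fst t, snd t + offset m)"
  by (simp add: upd_def act_def read_def)

lemma upd_Some [simp]: "upd (Some s, m) t = ((fst t)(snd t := s), snd t + offset m)"
  by (simp add: upd_def act_def)

definition apply_effect :: "effect \<Rightarrow> store \<Rightarrow> store" where
  "apply_effect a \<sigma> = (\<lambda>n. upd (a n) (\<sigma> n))"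

definition reads :: "store \<Rightarrow> nat \<Rightarrow> symbol" where
  "reads \<sigma> n = read (\<sigma> n)"

text \<open>The control is a partial function of the state and the symbols read: determinism is
  built in, and \<open>None\<close> means halting.\<close>

definition gstep :: "('s \<Rightarrow> (nat \<Rightarrow> symbol) \<Rightarrow> ('s \<times> effect) option) \<Rightarrow> 's \<times> store \<Rightarrow> 's \<times> store \<Rightarrow> bool" where
  "gstep d c c' \<longleftrightarrow> (\<exists>a. d (fst c) (reads (snd c)) = Some (fst c', a) \<and> snd c' = apply_effect a (snd c))"

definition init_store :: "bool list \<Rightarrow> store" where
  "init_store x = (\<lambda>n. if n = 0 then input_tape x else blank_tape)"

lemma relpowp_simulation:
  assumes "\<And>c c' d. R c c' \<Longrightarrow> I c d \<Longrightarrow> \<exists>d'. S d d' \<and> I c' d'"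
  shows "(R ^^ m) c c' \<Longrightarrow> I c d \<Longrightarrow> \<exists>d'. (S ^^ m) d d' \<and> I c' d'"
proof (induction m arbitrary: c')
  case 0
  then show ?case by auto
next
  case (Suc m)
  then obtain c1 where "(R ^^ m) c c1" "R c1 c'" by auto
  with Suc assms show ?case by (meson relpowp_Suc_I)
qed

text \<open>Without branching, every run from \<open>c\<close> is an initial part of the one that
  gets stuck. A single exhibited run thereby bounds all computations.\<close>

lemma relpowp_det_bound:
  assumes det: "\<forall>c d e. R c d \<longrightarrow> R c e \<longrightarrow> d = e"
    and "(R ^^ m) c d" "\<nexists>e. R d e" "(R ^^ k) c e"
  shows "k \<le> m \<and> (R ^^ (m - k)) e d"
  using assms(2,4)
proof (induction k arbitrary: c m)
  case 0
  then show ?case by simp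
next
  case (Suc k)
  from Suc.prems(2) obtain c1 where c1: "R c c1" "(R ^^ k) c1 e"
    by (metis relpowp_Suc_D2)
  show ?case
  proof (cases m)
    case 0
    with Suc.prems c1 assms(3) show ?thesis by auto
  next
    case (Suc m')
    with Suc.prems obtain c2 where "R c c2" "(R ^^ m') c2 d"
      by (metis relpowp_Suc_D2)
    with c1 det have "(R ^^ m') c1 d" by metis
    from Suc.IH[OF this c1(2)] Suc show ?thesis by simp
  qed
qed

lemma deterministic_step_unique:
  assumes "deterministic M" "step M c d" "step M c e"
  shows "d = e"
  using assms unfolding deterministic_def step_def single_valued_def
  by (metis prod.collapse prod.inject)

text \<open>
  A control \<open>d\<close> over an arbitrary type of states becomes a machine once its finitely many
  reachable states are numbered.
\<close>
lemma machine_of_control: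
  fixes d :: "'s \<Rightarrow> (nat \<Rightarrow> symbol) \<Rightarrow> ('s \<times> effect) option"
  assumes k: "k \<ge> 1" and finQ: "finite Q" and fin\<Sigma>: "finite \<Sigma>"
    and base: "q0 \<in> Q" "qacc \<in> Q" "Blank \<in> \<Sigma>" "range Bit \<subseteq> \<Sigma>"
    and closed: "\<And>q r q' a. q \<in> Q \<Longrightarrow> \<forall>i<k. r i \<in> \<Sigma> \<Longrightarrow> d q r = Some (q', a) \<Longrightarrow>
          q' \<in> Q \<and> (\<forall>i<k. \<forall>s. fst (a i) = Some s \<longrightarrow> s \<in> \<Sigma>)"
    and local: "\<And>q r r'. q \<in> Q \<Longrightarrow> \<forall>i<k. r i = r' i \<Longrightarrow> d q r = d q r'"
    and run: "\<And>x. \<exists>m qf \<sigma>. m \<le> T (length x) \<and> (gstep d ^^ m) (q0, init_store x) (qf, \<sigma>) \<and>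
          d qf (reads \<sigma>) = None \<and> (x \<in> L \<longleftrightarrow> qf = qacc)"
  shows "\<exists>N. wf_machine N \<and> deterministic N \<and> decides_in_time N T L"
proof -
  obtain enc :: "'s \<Rightarrow> nat" where enc: "inj_on enc Q"
    using finite_imp_inj_to_nat_seg[OF finQ] by blast
  define out :: "symbol list \<Rightarrow> effect \<Rightarrow> (symbol \<times> move) list" where
    "out ss a = map (\<lambda>i. (case fst (a i) of None \<Rightarrow> ss ! i | Some s \<Rightarrow> s, snd (a i))) [0..<k]" for ss a
  define Words where "Words = {ss. set ss \<subseteq> \<Sigma> \<and> length ss = k}"
  \<comment> \<open>Beyond the first \<open>k\<close> places \<open>(!) ss\<close> is unspecified;
    by the assumption \<open>local\<close>, \<open>d q\<close> does not look there.\<close>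
  define tr where "tr = (\<lambda>(q, ss). ((enc q, ss), (enc (fst (the (d q ((!) ss)))), out ss (snd (the (d q ((!) ss))))))) `
      {(q, ss). (q, ss) \<in> Q \<times> Words \<and> d q ((!) ss) \<noteq> None}"
  define N where "N = \<lparr>tapes = k, trans = tr, start = enc q0, accept = enc qacc\<rparr>"
  have "finite Words"
    unfolding Words_def by (rule finite_lists_length_eq[OF fin\<Sigma>])
  then have "finite {(q, ss). (q, ss) \<in> Q \<times> Words \<and> d q ((!) ss) \<noteq> None}"
    using finQ by (elim finite_subset[OF _ finite_cartesian_product, rotated 2]) auto
  then have "finite tr" unfolding tr_def by simp
  then have wf: "wf_machine N"
    using k by (auto simp: wf_machine_def N_def tr_def Words_def out_def)
  have det: "deterministic N"
    unfolding deterministic_def single_valued_def N_def tr_def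
    using enc by (auto dest: inj_onD)
  \<comment> \<open>The symbols on the first \<open>k\<close> tapes have to stay in
    \<open>\<Sigma>\<close>, since \<open>tr\<close> has transitions for words over
    \<open>\<Sigma>\<close> only.\<close>
  define I where "I c c' \<longleftrightarrow> fst c \<in> Q \<and> (\<forall>i<k. \<forall>p. fst (snd c i) p \<in> \<Sigma>) \<and>
      c' = (enc (fst c), map (snd c) [0..<k])" for c :: "'s \<times> store" and c' :: config
  have rd: "map read (map \<sigma> [0..<k]) \<in> Words" "d q ((!) (map read (map \<sigma> [0..<k]))) = d q (reads \<sigma>)"
    if "\<forall>i<k. \<forall>p. fst (\<sigma> i) p \<in> \<Sigma>" "q \<in> Q" for \<sigma> q
  proof -
    show "map read (map \<sigma> [0..<k]) \<in> Words"
      using that unfolding Words_def by (auto simp: read_def)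
    show "d q ((!) (map read (map \<sigma> [0..<k]))) = d q (reads \<sigma>)"
      by (rule local[OF that(2)]) (auto simp: reads_def)
  qed
  have sim: "\<exists>e'. step N e e' \<and> I c' e'" if "gstep d c c'" "I c e" for c c' e
  proof -
    obtain q \<sigma> where c: "c = (q, \<sigma>)" by force
    obtain q' \<sigma>' where c': "c' = (q', \<sigma>')" by force
    from that c c' obtain a where a: "d q (reads \<sigma>) = Some (q', a)" "\<sigma>' = apply_effect a \<sigma>"
      by (auto simp: gstep_def)
    from that(2) c have q: "q \<in> Q" and s: "\<forall>i<k. \<forall>p. fst (\<sigma> i) p \<in> \<Sigma>"
      and e: "e = (enc q, map \<sigma> [0..<k])" by (auto simp: I_def)
    let ?ss = "map read (map \<sigma> [0..<k])"
    have "((enc q, ?ss), (enc q', out ?ss a)) \<in> tr"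
      unfolding tr_def
      by (rule image_eqI[of _ _ "(q, ?ss)"]) (use rd[OF s q] q a in simp_all)
    moreover have "map \<sigma>' [0..<k] = map2 act (out ?ss a) (map \<sigma> [0..<k])"
      by (rule nth_equalityI) (auto simp: out_def a apply_effect_def upd_def split: option.split)
    ultimately have st: "step N e (enc q', map \<sigma>' [0..<k])"
      unfolding step_def e N_def by auto
    have "\<forall>i<k. reads \<sigma> i \<in> \<Sigma>" using s by (auto simp: reads_def read_def)
    from closed[OF q this a(1)] have "q' \<in> Q" "\<forall>i<k. \<forall>s. fst (a i) = Some s \<longrightarrow> s \<in> \<Sigma>" by auto
    then have "I c' (enc q', map \<sigma>' [0..<k])"
      using s unfolding I_def c' a
      by (auto simp: apply_effect_def upd_def act_def read_def split: option.splits)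
    with st show ?thesis by blast
  qed
  have dec: "(\<forall>m c. (step N ^^ m) (initial N x) c \<longrightarrow> m \<le> T (length x)) \<and> (x \<in> L \<longleftrightarrow> accepts N x)" for x
  proof -
    obtain m qf \<sigma> where m: "m \<le> T (length x)" and go: "(gstep d ^^ m) (q0, init_store x) (qf, \<sigma>)"
      and stop: "d qf (reads \<sigma>) = None" and L: "x \<in> L \<longleftrightarrow> qf = qacc"
      using run[of x] by blast
    have "initial N x = (enc q0, map (init_store x) [0..<k])"
      unfolding initial_def N_def using k
      by (auto intro!: nth_equalityI simp: init_store_def nth_Cons')
    then have "I (q0, init_store x) (initial N x)"
      using base by (auto simp: I_def init_store_def input_tape_def blank_tape_def)
    then have "\<exists>e. (step N ^^ m) (initial N x) e \<and> I (qf, \<sigma>) e"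
      by (intro relpowp_simulation[where R = "gstep d" and I = I, OF _ go] sim)
    then obtain e where e: "(step N ^^ m) (initial N x) e" "I (qf, \<sigma>) e"
      by blast
    have qf: "qf \<in> Q" and s: "\<forall>i<k. \<forall>p. fst (\<sigma> i) p \<in> \<Sigma>" and e': "e = (enc qf, map \<sigma> [0..<k])"
      using e(2) by (auto simp: I_def)
    have h: "\<nexists>e'. step N e e'"
    proof
      assume "\<exists>e'. step N e e'"
      then obtain y where "((enc qf, map read (map \<sigma> [0..<k])), y) \<in> tr"
        unfolding step_def e' N_def by auto
      then obtain q where "q \<in> Q" "enc q = enc qf" "d q ((!) (map read (map \<sigma> [0..<k]))) \<noteq> None"
        unfolding tr_def by auto
      then show False using rd(2)[OF s qf] stop inj_onD[OF enc] qf by metis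
    qed
    have bd: "j \<le> m \<and> (step N ^^ (m - j)) c e" if "(step N ^^ j) (initial N x) c" for j c
      using relpowp_det_bound[OF _ e(1) h that] deterministic_step_unique[OF det] by blast
    have "accepts N x \<longleftrightarrow> qf = qacc"
    proof
      assume "accepts N x"
      then obtain c j where c: "(step N ^^ j) (initial N x) c" "halted N c" "fst c = enc qacc"
        unfolding accepts_def by (auto simp: rtranclp_power N_def)
      have "m - j = 0"
        using bd[OF c(1)] c(2) unfolding halted_def
        by (metis not0_implies_Suc relpowp_Suc_D2)
      with bd[OF c(1)] have "c = e" by simp
      with c(3) e' qf base enc show "qf = qacc" by (auto dest: inj_onD)
    next
      assume "qf = qacc"
      then show "accepts N x"
        unfolding accepts_def halted_def using h e(1) e'
        by (auto simp: N_def intro!: exI[of _ e] relpowp_imp_rtranclp[of m])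
    qed
    with L m bd show ?thesis by fastforce
  qed
  then show ?thesis
    using wf det unfolding decides_in_time_def by blast
qed

section \<open>Programs\<close>

text \<open>The branches of \<open>Case\<close> form a function on symbols. Whatever depends on a
  bounded number of symbols read can thus be computed in the logic when the program is formed, not
  by the program.\<close>

datatype cmd =
    Act effect
  | Seq cmd cmd
  | Case nat "symbol \<Rightarrow> cmd"
  | While nat cmd
  | Skip

abbreviation idle :: effect where "idle \<equiv> \<lambda>_. (None, Stay)"

lemma apply_idle [simp]: "apply_effect idle \<sigma> = \<sigma>"
  by (simp add: apply_effect_def)

fun cmd_control :: "cmd list \<Rightarrow> (nat \<Rightarrow> symbol) \<Rightarrow> (cmd list \<times> effect) option" where
  "cmd_control [] r = None"
| "cmd_control (Act a # K) r = Some (K, a)"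
| "cmd_control (Seq c d # K) r = Some (c # d # K, idle)"
| "cmd_control (Case j f # K) r = Some (f (r j) # K, idle)"
| "cmd_control (While j c # K) r = Some (if r j \<noteq> Blank then c # While j c # K else K, idle)"
| "cmd_control (Skip # K) r = Some (K, idle)"

text \<open>These are the continuations that occur until \<open>K\<close> is reached. The set is
  finite because the body of a loop is continued by the loop itself, not by a growing stack, and
  because only branches for symbols in \<open>\<Sigma>\<close> are followed.\<close>

primrec conts :: "symbol set \<Rightarrow> cmd \<Rightarrow> cmd list \<Rightarrow> cmd list set" where
  "conts \<Sigma> (Act a) = (\<lambda>K. {Act a # K})"
| "conts \<Sigma> (Seq c d) = (\<lambda>K. insert (Seq c d # K) (conts \<Sigma> c (d # K) \<union> conts \<Sigma> d K))"
| "conts \<Sigma> (Case j f) = (\<lambda>K. insert (Case j f # K) (\<Union>s\<in>\<Sigma>. conts \<Sigma> (f s) K))"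
| "conts \<Sigma> (While j c) = (\<lambda>K. insert (While j c # K) (conts \<Sigma> c (While j c # K)))"
| "conts \<Sigma> Skip = (\<lambda>K. {Skip # K})"

primrec wf_cmd :: "nat \<Rightarrow> symbol set \<Rightarrow> cmd \<Rightarrow> bool" where
  "wf_cmd k \<Sigma> (Act a) \<longleftrightarrow> (\<forall>i. \<forall>s. fst (a i) = Some s \<longrightarrow> s \<in> \<Sigma>)"
| "wf_cmd k \<Sigma> (Seq c d) \<longleftrightarrow> wf_cmd k \<Sigma> c \<and> wf_cmd k \<Sigma> d"
| "wf_cmd k \<Sigma> (Case j f) \<longleftrightarrow> j < k \<and> (\<forall>s. wf_cmd k \<Sigma> (f s))"
| "wf_cmd k \<Sigma> (While j c) \<longleftrightarrow> j < k \<and> wf_cmd k \<Sigma> c"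
| "wf_cmd k \<Sigma> Skip \<longleftrightarrow> True"

lemma finite_conts: "finite \<Sigma> \<Longrightarrow> finite (conts \<Sigma> c K)"
  by (induction c arbitrary: K) auto

lemma conts_self: "c # K \<in> conts \<Sigma> c K"
  by (induction c) auto

lemma conts_closed:
  assumes "L \<in> conts \<Sigma> c K" "\<And>i. i < k \<Longrightarrow> r i \<in> \<Sigma>" "wf_cmd k \<Sigma> c" "cmd_control L r = Some (L', a)"
  shows "(L' \<in> conts \<Sigma> c K \<or> L' = K) \<and> (\<forall>i s. fst (a i) = Some s \<longrightarrow> s \<in> \<Sigma>)"
  using assms
proof (induction c arbitrary: K)
  case (Seq c d)
  then show ?case using conts_self[of c "d # K" \<Sigma>] conts_self[of d K \<Sigma>] by auto
next
  case (Case j f)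
  show ?case
  proof (cases "L = Case j f # K")
    case True
    then show ?thesis using Case.prems conts_self[of "f (r j)" K \<Sigma>] by auto
  next
    case False
    then obtain s where "s \<in> \<Sigma>" "L \<in> conts \<Sigma> (f s) K" using Case.prems by auto
    then show ?thesis using Case.IH[of "f s" K] Case.prems by auto
  qed
next
  case (While j c)
  then show ?case using conts_self[of c "While j c # K" \<Sigma>] by (auto split: if_splits)
qed auto

lemma conts_local:
  assumes "L \<in> conts \<Sigma> c K" "wf_cmd k \<Sigma> c" "\<And>i. i < k \<Longrightarrow> r i = r' i" "L \<noteq> K"
  shows "cmd_control L r = cmd_control L r'"
  using assms
proof (induction c arbitrary: K)
  case (Seq c d)
  then show ?case by (cases "L = d # K") (auto, (cases d; auto)+)
next
  case (Case j f)
  then show ?case by auto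
next
  case (While j c)
  then show ?case by (cases "L = While j c # K") auto
qed auto

text \<open>Quantifying over the continuation \<open>K\<close> makes runs compose; a bound on the
  number of steps, in place of the exact number, allows branches of different lengths.\<close>

definition runs :: "cmd \<Rightarrow> store \<Rightarrow> nat \<Rightarrow> store \<Rightarrow> bool" where
  "runs c \<sigma> b \<sigma>' \<longleftrightarrow> (\<forall>K. \<exists>n\<le>b. (gstep cmd_control ^^ n) (c # K, \<sigma>) (K, \<sigma>'))"

lemma gstep_Some:
  "d q (reads \<sigma>) = Some (q', a) \<Longrightarrow> gstep d (q, \<sigma>) (q', apply_effect a \<sigma>)"
  by (auto simp: gstep_def)

lemma runs_mono: "runs c \<sigma> b \<sigma>' \<Longrightarrow> b \<le> b' \<Longrightarrow> runs c \<sigma> b' \<sigma>'"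
  unfolding runs_def by (meson order_trans)

lemma runs_weaken: "runs c \<sigma> b \<tau> \<Longrightarrow> b \<le> b' \<Longrightarrow> \<tau> = \<tau>' \<Longrightarrow> runs c \<sigma> b' \<tau>'"
  using runs_mono by blast

lemma runs_step:
  assumes "\<And>K. gstep cmd_control (c # K, \<sigma>) (ds @ K, \<sigma>1)"
    and "\<And>K. \<exists>n\<le>b. (gstep cmd_control ^^ n) (ds @ K, \<sigma>1) (K, \<sigma>')"
  shows "runs c \<sigma> (Suc b) \<sigma>'"
  unfolding runs_def using assms by (metis Suc_le_mono relpowp_Suc_I2)

lemma runs_Act: "runs (Act a) \<sigma> 1 (apply_effect a \<sigma>)"
  using runs_step[of "Act a" \<sigma> "[]" "apply_effect a \<sigma>" 0] gstep_Some[of cmd_control]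
  by (simp add: eval_nat_numeral)

lemma runs_Skip: "runs Skip \<sigma> 1 \<sigma>"
  using runs_step[of Skip \<sigma> "[]" \<sigma> 0] gstep_Some[of cmd_control _ _ _ idle]
  by (simp add: eval_nat_numeral)

lemma runs_list2:
  assumes "runs c \<sigma> b \<sigma>1" "runs d \<sigma>1 b' \<sigma>2"
  shows "\<exists>n\<le>b + b'. (gstep cmd_control ^^ n) ([c, d] @ K, \<sigma>) (K, \<sigma>2)"
proof -
  obtain n where "n \<le> b" "(gstep cmd_control ^^ n) (c # d # K, \<sigma>) (d # K, \<sigma>1)"
    using assms(1) unfolding runs_def by blast
  moreover obtain m where "m \<le> b'" "(gstep cmd_control ^^ m) (d # K, \<sigma>1) (K, \<sigma>2)"
    using assms(2) unfolding runs_def by blast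
  ultimately show ?thesis
    by (intro exI[of _ "n + m"]) (auto intro: relpowp_trans)
qed

lemma runs_Seq:
  assumes "runs c \<sigma> b \<sigma>1" "runs d \<sigma>1 b' \<sigma>2"
  shows "runs (Seq c d) \<sigma> (b + b' + 1) \<sigma>2"
  using runs_step[of "Seq c d" \<sigma> "[c, d]" \<sigma> "b + b'" \<sigma>2] runs_list2[OF assms]
    gstep_Some[of cmd_control _ _ _ idle] by simp

lemma runs_Case:
  assumes "runs (f (reads \<sigma> j)) \<sigma> b \<sigma>'"
  shows "runs (Case j f) \<sigma> (b + 1) \<sigma>'"
  using runs_step[of "Case j f" \<sigma> "[f (reads \<sigma> j)]" \<sigma> "b" \<sigma>'] assms
    gstep_Some[of cmd_control _ _ _ idle] by (simp add: runs_def)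

lemma runs_While_False: "reads \<sigma> j = Blank \<Longrightarrow> runs (While j c) \<sigma> 1 \<sigma>"
  using runs_step[of "While j c" \<sigma> "[]" \<sigma> 0] gstep_Some[of cmd_control _ _ _ idle]
  by (simp add: eval_nat_numeral)

lemma runs_While_True:
  assumes "reads \<sigma> j \<noteq> Blank" "runs c \<sigma> b \<sigma>1" "runs (While j c) \<sigma>1 b' \<sigma>2"
  shows "runs (While j c) \<sigma> (b + b' + 1) \<sigma>2"
  using runs_step[of "While j c" \<sigma> "[c, While j c]" \<sigma> "b + b'" \<sigma>2] runs_list2[OF assms(2,3)]
    gstep_Some[of cmd_control _ _ _ idle] assms(1) by simp

section \<open>Running a program and negating the answer of a machine\<close>

datatype control = Prog "cmd list" | Sim nat | Halt bool

text \<open>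
  The tapes of \<open>A\<close> are those from index \<open>p\<close> on.
\<close>
fun negated_run :: "machine \<Rightarrow> nat \<Rightarrow> control \<Rightarrow> (nat \<Rightarrow> symbol) \<Rightarrow> (control \<times> effect) option" where
  "negated_run A p (Prog K) r =
     (case cmd_control K r of None \<Rightarrow> Some (Sim (start A), idle) | Some (K', a) \<Rightarrow> Some (Prog K', a))"
| "negated_run A p (Sim q) r =
     (let ss = map r [p..<p + tapes A] in
      if \<exists>y. ((q, ss), y) \<in> trans A
      then let (q', as) = (SOME y. ((q, ss), y) \<in> trans A)
           in Some (Sim q', \<lambda>i. if p \<le> i \<and> i < p + tapes A
                then (Some (fst (as ! (i - p))), snd (as ! (i - p))) else (None, Stay))
      else Some (Halt (q \<noteq> accept A), idle))"
| "negated_run A p (Halt b) r = None"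

text \<open>Besides blanks and input bits only written symbols are collected: a transition that
  reads any other symbol can never be taken from an initial configuration.\<close>

definition machine_symbols :: "machine \<Rightarrow> symbol set" where
  "machine_symbols M = {Blank, Bit True, Bit False} \<union> (\<Union>(_, (_, as)) \<in> trans M. fst ` set as)"

definition machine_states :: "machine \<Rightarrow> nat set" where
  "machine_states M = insert (start M) ((fst \<circ> snd) ` trans M)"

lemma finite_machine_symbols: "wf_machine M \<Longrightarrow> finite (machine_symbols M)"
  by (auto simp: machine_symbols_def wf_machine_def)

lemma finite_machine_states: "wf_machine M \<Longrightarrow> finite (machine_states M)"
  by (auto simp: machine_states_def wf_machine_def)

lemma map_upt_shift: "map \<sigma> [p..<p + n] = map (\<lambda>i. \<sigma> (p + i)) [0..<n]"
  by (rule nth_equalityI) auto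

lemma gstep_Sim:
  assumes A: "wf_machine A" "deterministic A"
    and st: "step A c c'" and sim: "snd c = map \<sigma> [p..<p + tapes A]"
  shows "\<exists>\<sigma>'. gstep (negated_run A p) (Sim (fst c), \<sigma>) (Sim (fst c'), \<sigma>') \<and> snd c' = map \<sigma>' [p..<p + tapes A]"
proof -
  let ?ss = "map (reads \<sigma>) [p..<p + tapes A]"
  have rd: "map read (snd c) = ?ss" by (simp add: sim reads_def)
  from st rd obtain as where as: "((fst c, ?ss), (fst c', as)) \<in> trans A" "snd c' = map2 act as (snd c)"
    unfolding step_def by auto
  have "length as = tapes A" using A(1) as(1) by (auto simp: wf_machine_def)
  have some: "(SOME y. ((fst c, ?ss), y) \<in> trans A) = (fst c', as)"
    using A(2) as(1) unfolding deterministic_def single_valued_def by blast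
  let ?a = "\<lambda>i. if p \<le> i \<and> i < p + tapes A
                then (Some (fst (as ! (i - p))), snd (as ! (i - p))) else (None, Stay)"
  have "negated_run A p (Sim (fst c)) (reads \<sigma>) = Some (Sim (fst c'), ?a)"
    using as(1) some by (auto simp: Let_def)
  moreover have "snd c' = map (apply_effect ?a \<sigma>) [p..<p + tapes A]"
    unfolding as(2) sim
    by (rule nth_equalityI) (simp_all add: \<open>length as = tapes A\<close> apply_effect_def upd_def)
  ultimately show ?thesis
    by (intro exI[of _ "apply_effect ?a \<sigma>"] conjI) (rule gstep_Some)
qed

lemma gsteps_Sim:
  assumes A: "wf_machine A" "deterministic A"
    and st: "(step A ^^ m) c c'" and sim: "snd c = map \<sigma> [p..<p + tapes A]"
  shows "\<exists>\<sigma>'. (gstep (negated_run A p) ^^ m) (Sim (fst c), \<sigma>) (Sim (fst c'), \<sigma>') \<and>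
    snd c' = map \<sigma>' [p..<p + tapes A]"
proof -
  let ?I = "\<lambda>c d. \<exists>\<sigma>. d = (Sim (fst c), \<sigma>) \<and> snd c = map \<sigma> [p..<p + tapes A]"
  have "\<exists>d'. (gstep (negated_run A p) ^^ m) (Sim (fst c), \<sigma>) d' \<and> ?I c' d'"
  proof (rule relpowp_simulation[where R = "step A" and I = ?I, OF _ st])
    show "\<exists>d'. gstep (negated_run A p) d d' \<and> ?I c' d'" if "step A c c'" "?I c d" for c c' d
      using gstep_Sim[OF A that(1)] that(2) by fastforce
  qed (use sim in auto)
  then show ?thesis by auto
qed

text \<open>Otherwise every run could be extended, and there would be one of length
  \<open>Suc b\<close>. This yields a halting computation from a definition that merely forbids long
  ones.\<close>

lemma terminating_run:
  assumes "\<forall>m c'. (R ^^ m) c c' \<longrightarrow> m \<le> (b::nat)"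
  shows "\<exists>m\<le>b. \<exists>c'. (R ^^ m) c c' \<and> (\<nexists>c''. R c' c'')"
proof (rule ccontr)
  assume neg: "\<not> ?thesis"
  have "\<exists>c'. (R ^^ m) c c'" for m
  proof (induction m)
    case (Suc m)
    with neg assms show ?case by (meson relpowp_Suc_I)
  qed auto
  then obtain c' where "(R ^^ Suc b) c c'" by blast
  with assms have "Suc b \<le> b" by blast
  then show False by simp
qed

text \<open>The program leaves \<open>f x\<close> on the tapes from \<open>p\<close> on, exactly as
  an initial configuration of \<open>A\<close>; the control then follows \<open>A\<close> and flips
  the answer. The summand 2 counts the step that starts \<open>A\<close> and the one that negates
  its answer.\<close>

lemma machine_of_reduction:
  assumes A: "wf_machine A" "deterministic A" "decides_in_time A q L'"
    and k: "p + tapes A \<le> k" and fin\<Sigma>: "finite \<Sigma>" and sub: "machine_symbols A \<subseteq> \<Sigma>"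
    and wf: "wf_cmd k \<Sigma> c"
    and run: "\<And>x. \<exists>\<sigma>. runs c (init_store x) (b x) \<sigma> \<and> map \<sigma> [p..<p + tapes A] = snd (initial A (f x))"
    and bound: "\<And>x. b x + q (length (f x)) + 2 \<le> T (length x)"
    and red: "\<And>x. x \<in> L \<longleftrightarrow> f x \<notin> L'"
  shows "\<exists>N. wf_machine N \<and> deterministic N \<and> decides_in_time N T L"
proof (rule machine_of_control)
  let ?Q = "Prog ` insert [] (conts \<Sigma> c []) \<union> Sim ` machine_states A \<union> range Halt"
  let ?d = "negated_run A p"
  show "finite ?Q" using finite_conts[OF fin\<Sigma>] finite_machine_states[OF A(1)] by simp
  show "finite \<Sigma>" by fact
  show "1 \<le> k" using A(1) k by (auto simp: wf_machine_def)
  show "Prog [c] \<in> ?Q" using conts_self by simp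
  show "Halt True \<in> ?Q" by simp
  show "Blank \<in> \<Sigma>" "range Bit \<subseteq> \<Sigma>" using sub by (auto simp: machine_symbols_def full_SetCompr_eq UNIV_bool)
  show "q' \<in> ?Q \<and> (\<forall>i<k. \<forall>s. fst (a i) = Some s \<longrightarrow> s \<in> \<Sigma>)"
    if q: "q \<in> ?Q" and r: "\<forall>i<k. r i \<in> \<Sigma>" and d: "?d q r = Some (q', a)" for q r q' a
  proof (cases q)
    case (Prog K)
    show ?thesis
    proof (cases "cmd_control K r")
      case None
      then show ?thesis using d Prog by (auto simp: machine_states_def)
    next
      case (Some y)
      then have "K \<noteq> []" "cmd_control K r = Some (fst y, a)" "q' = Prog (fst y)"
        using d Prog by (cases y; auto)+
      moreover have "K \<in> conts \<Sigma> c []" using q Prog \<open>K \<noteq> []\<close> by auto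
      ultimately show ?thesis using conts_closed[of K \<Sigma> c "[]" k r "fst y" a] wf r by auto
    qed
  next
    case (Sim s)
    let ?ss = "map r [p..<p + tapes A]"
    show ?thesis
    proof (cases "\<exists>y. ((s, ?ss), y) \<in> trans A")
      case True
      obtain s' as where so: "(SOME y. ((s, ?ss), y) \<in> trans A) = (s', as)" by fastforce
      with someI_ex[OF True] have so2: "((s, ?ss), (s', as)) \<in> trans A" by simp
      then have "length as = tapes A" using A(1) so2 by (auto simp: wf_machine_def)
      then have "fst (as ! i) \<in> machine_symbols A" if "i < tapes A" for i
        using so2 that unfolding machine_symbols_def by (auto intro!: bexI[OF _ so2])
      then have "fst (as ! (i - p)) \<in> \<Sigma>" if "p \<le> i" "i < p + tapes A" for i
        using that sub by (metis less_diff_conv2 add.commute subsetD)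
      moreover have "s' \<in> machine_states A" using so2 by (force simp: machine_states_def)
      ultimately show ?thesis
        using d Sim True so sub by (auto simp: Let_def split: if_splits)
    next
      case False
      then show ?thesis using d Sim by auto
    qed
  next
    case (Halt b)
    then show ?thesis using d by simp
  qed
  show "?d q r = ?d q r'" if "q \<in> ?Q" "\<forall>i<k. r i = r' i" for q r r'
  proof (cases q)
    case (Prog K)
    then show ?thesis using that conts_local[of K \<Sigma> c "[]" k r r'] wf by (cases K) auto
  next
    case (Sim s)
    have "map r [p..<p + tapes A] = map r' [p..<p + tapes A]"
      using that k by auto
    then show ?thesis unfolding Sim negated_run.simps by metis
  next
    case (Halt b)
    then show ?thesis by simp
  qed
  show "\<exists>m qf \<sigma>. m \<le> T (length x) \<and> (gstep ?d ^^ m) (Prog [c], init_store x) (qf, \<sigma>) \<and>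
      ?d qf (reads \<sigma>) = None \<and> (x \<in> L \<longleftrightarrow> qf = Halt True)" for x
  proof -
    obtain \<sigma> where \<sigma>: "runs c (init_store x) (b x) \<sigma>" "map \<sigma> [p..<p + tapes A] = snd (initial A (f x))"
      using run by blast
    obtain n where n: "n \<le> b x" "(gstep cmd_control ^^ n) ([c], init_store x) ([], \<sigma>)"
      using \<sigma>(1) unfolding runs_def by blast
    have "\<exists>d'. (gstep ?d ^^ n) (Prog [c], init_store x) d' \<and> d' = (Prog (fst ([], \<sigma>)), snd ([]::cmd list, \<sigma>))"
      by (rule relpowp_simulation[where R = "gstep cmd_control" and I = "\<lambda>c d. d = (Prog (fst c), snd c)", OF _ n(2)])
        (auto simp: gstep_def)
    then have 1: "(gstep ?d ^^ n) (Prog [c], init_store x) (Prog [], \<sigma>)" by simp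
    have 2: "gstep ?d (Prog [], \<sigma>) (Sim (start A), \<sigma>)"
      using gstep_Some[of ?d "Prog []" \<sigma> "Sim (start A)" idle] by simp
    have "\<forall>m c'. (step A ^^ m) (initial A (f x)) c' \<longrightarrow> m \<le> q (length (f x))"
      using A(3) by (auto simp: decides_in_time_def)
    from terminating_run[OF this] obtain m c' where m: "m \<le> q (length (f x))"
      "(step A ^^ m) (initial A (f x)) c'" "\<nexists>c''. step A c' c''" by blast
    from gsteps_Sim[OF A(1,2) m(2) \<sigma>(2)[symmetric]] obtain \<sigma>' where
      3: "(gstep ?d ^^ m) (Sim (start A), \<sigma>) (Sim (fst c'), \<sigma>')"
      and s': "snd c' = map \<sigma>' [p..<p + tapes A]" by (auto simp: initial_def)
    have "\<nexists>y. ((fst c', map (reads \<sigma>') [p..<p + tapes A]), y) \<in> trans A"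
    proof
      assume "\<exists>y. ((fst c', map (reads \<sigma>') [p..<p + tapes A]), y) \<in> trans A"
      then obtain q' as where "((fst c', map read (snd c')), (q', as)) \<in> trans A"
        by (auto simp: s' comp_def simp flip: reads_def)
      then have "step A c' (q', map2 act as (snd c'))" unfolding step_def by auto
      with m(3) show False by blast
    qed
    then have "?d (Sim (fst c')) (reads \<sigma>') = Some (Halt (fst c' \<noteq> accept A), idle)"
      by (simp add: Let_def)
    from gstep_Some[of ?d, OF this]
    have 4: "gstep ?d (Sim (fst c'), \<sigma>') (Halt (fst c' \<noteq> accept A), \<sigma>')" by simp
    have "(gstep ?d ^^ (Suc n)) (Prog [c], init_store x) (Sim (start A), \<sigma>)"
      using 1 2 by (rule relpowp_Suc_I)
    from relpowp_Suc_I[OF relpowp_trans[OF this 3] 4]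
    have "(gstep ?d ^^ (Suc (Suc n + m))) (Prog [c], init_store x) (Halt (fst c' \<noteq> accept A), \<sigma>')" .
    moreover have "Suc (Suc n + m) \<le> T (length x)" using n(1) m(1) bound[of x] by linarith
    \<comment> \<open>Acceptance asks for some accepting computation, so inspecting one final state
      is conclusive only because \<open>A\<close> is deterministic.\<close>
    moreover have "x \<in> L \<longleftrightarrow> fst c' \<noteq> accept A"
    proof -
      have "accepts A (f x) \<longleftrightarrow> fst c' = accept A"
      proof
        assume "accepts A (f x)"
        then obtain e j where e: "(step A ^^ j) (initial A (f x)) e" "halted A e" "fst e = accept A"
          unfolding accepts_def by (auto simp: rtranclp_power)
        have *: "\<forall>c d e. step A c d \<longrightarrow> step A c e \<longrightarrow> d = e"
          using deterministic_step_unique[OF A(2)] by blast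
        have "j \<le> m \<and> (step A ^^ (m - j)) e c'"
          using relpowp_det_bound[OF * m(2) m(3) e(1)] by blast
        then have "e = c'" using e(2) unfolding halted_def
          by (metis not0_implies_Suc relpowp_Suc_D2 relpowp_0_E)
        then show "fst c' = accept A" using e by simp
      next
        assume "fst c' = accept A"
        then show "accepts A (f x)"
          using m unfolding accepts_def halted_def by (meson relpowp_imp_rtranclp)
      qed
      then show ?thesis using red[of x] A(3) by (auto simp: decides_in_time_def)
    qed
    ultimately show ?thesis by (intro exI[of _ "Suc (Suc n + m)"] exI[of _ "Halt (fst c' \<noteq> accept A)"] exI[of _ \<sigma>']) auto
  qed
qed

section \<open>The graph of a computation\<close>

lemma independent_setD: "independent_set V E S \<Longrightarrow> u \<in> S \<Longrightarrow> v \<in> S \<Longrightarrow> u \<noteq> v \<Longrightarrow> {u, v} \<notin> E"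
  by (auto simp: independent_set_def pairwise_def)

text \<open>By \<open>ZV\<close> an independent set lies inside \<open>Z\<close> or outside.
  Outside, \<open>VV\<close> allows at most one vertex per cell, so there are at most
  \<open>card Z\<close> vertices, of weight at most 1 each. Equality forces a vertex of weight 1 in
  every cell, which is a choice function \<open>g\<close>; inside, equality forces \<open>Z\<close>
  itself.\<close>

lemma unique_mwis_with_fallback:
  assumes G: "simple_graph V E" and w: "\<And>v. v \<in> V \<Longrightarrow> w v \<le> 1"
    and Z: "Z \<subseteq> V" "Z \<noteq> {}" "inj_on cell Z" "cell ` V \<subseteq> cell ` Z" "\<And>v. v \<in> Z \<Longrightarrow> w v = 1"
    and ZZ: "\<And>u v. u \<in> Z \<Longrightarrow> v \<in> Z \<Longrightarrow> {u, v} \<notin> E"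
    and ZV: "\<And>u v. u \<in> Z \<Longrightarrow> v \<in> V - Z \<Longrightarrow> {u, v} \<in> E"
    and VV: "\<And>u v. u \<in> V - Z \<Longrightarrow> v \<in> V - Z \<Longrightarrow> u \<noteq> v \<Longrightarrow> cell u = cell v \<Longrightarrow> {u, v} \<in> E"
  shows "has_unique_mwis V E w \<longleftrightarrow>
    \<not> (\<exists>g. \<forall>c\<in>cell ` Z. g c \<in> V - Z \<and> cell (g c) = c \<and> w (g c) = 1 \<and> (\<forall>c'\<in>cell ` Z. {g c, g c'} \<notin> E))"
    (is "_ \<longleftrightarrow> \<not> (\<exists>g. ?choice g)")
proof -
  have fin: "finite V" using G by (simp add: simple_graph_def)
  then have finZ: "finite Z" using Z(1) finite_subset by blast
  have dich: "S \<subseteq> Z \<or> S \<subseteq> V - Z" if S: "independent_set V E S" for S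
  proof (rule ccontr)
    assume "\<not> (S \<subseteq> Z \<or> S \<subseteq> V - Z)"
    then obtain u v where "u \<in> S" "u \<in> Z" "v \<in> S" "v \<in> V - Z"
      using S unfolding independent_set_def by blast
    with ZV independent_setD[OF S] show False by blast
  qed
  have inj: "inj_on cell S" if "independent_set V E S" "S \<subseteq> V - Z" for S
    using VV independent_setD[OF that(1)] that(2) by (meson inj_onI subsetD)
  have card_le: "card S \<le> card Z" if "independent_set V E S" for S
    using dich[OF that]
  proof
    assume "S \<subseteq> V - Z"
    then have "cell ` S \<subseteq> cell ` Z" using Z(4) by blast
    then have "card (cell ` S) \<le> card (cell ` Z)" using finZ by (simp add: card_mono)
    then show ?thesis using card_image[OF inj[OF that \<open>S \<subseteq> V - Z\<close>]] card_image[OF Z(3)] by simp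
  qed (simp add: card_mono finZ)
  have w_le: "weight w S \<le> card S" if "S \<subseteq> V" for S
  proof -
    have "weight w S \<le> (\<Sum>v\<in>S. 1)" unfolding weight_def by (intro sum_mono w) (use that in auto)
    then show ?thesis by simp
  qed
  have wZ: "weight w Z = card Z" using Z(5) by (simp add: weight_def)
  have indZ: "independent_set V E Z" using ZZ Z(1) by (auto simp: independent_set_def pairwise_def)
  have sub: "S \<subseteq> V" if "independent_set V E S" for S using that by (simp add: independent_set_def)
  have max: "max_independent_weight V E w = card Z"
    unfolding max_independent_weight_def
  proof (rule Max_eqI)
    show "finite (weight w ` {S. independent_set V E S})"
    proof (rule finite_imageI)
      show "finite {S. independent_set V E S}"
        by (rule finite_subset[of _ "Pow V"]) (use fin sub in auto)
    qed
    show "y \<le> card Z" if "y \<in> weight w ` {S. independent_set V E S}" for y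
      using that card_le w_le[OF sub] by (auto intro: order_trans)
    show "card Z \<in> weight w ` {S. independent_set V E S}"
      using wZ indZ by (metis (mono_tags) image_eqI mem_Collect_eq)
  qed
  have uniq: "has_unique_mwis V E w \<longleftrightarrow>
      \<not> (\<exists>S. independent_set V E S \<and> weight w S = card Z \<and> S \<noteq> Z)"
    unfolding has_unique_mwis_def max using indZ wZ by blast
  have "(\<exists>S. independent_set V E S \<and> weight w S = card Z \<and> S \<noteq> Z) \<longleftrightarrow> (\<exists>g. ?choice g)"
  proof
    assume "\<exists>S. independent_set V E S \<and> weight w S = card Z \<and> S \<noteq> Z"
    then obtain S where S: "independent_set V E S" "weight w S = card Z" "S \<noteq> Z" by blast
    have cS: "card S = card Z" using card_le[OF S(1)] w_le[OF sub[OF S(1)]] S(2) by simp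
    then have "S \<subseteq> V - Z" using dich[OF S(1)] card_subset_eq[OF finZ] S(3) by blast
    note injS = inj[OF S(1) this]
    have finS: "finite S" using fin sub[OF S(1)] finite_subset by blast
    have "w v = 1" if "v \<in> S" for v
    proof (rule ccontr)
      assume "w v \<noteq> 1"
      then have "w v < 1" using w that \<open>S \<subseteq> V - Z\<close> by (metis DiffD1 le_neq_implies_less subsetD)
      then have "weight w S < (\<Sum>v\<in>S. 1)"
        unfolding weight_def using that w \<open>S \<subseteq> V - Z\<close> finS by (intro sum_strict_mono_ex1) auto
      with S(2) cS show False by simp
    qed
    moreover have im: "cell ` S = cell ` Z"
    proof (rule card_subset_eq)
      show "cell ` S \<subseteq> cell ` Z" using Z(4) \<open>S \<subseteq> V - Z\<close> by blast
      show "card (cell ` S) = card (cell ` Z)"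
        using cS card_image[OF injS] card_image[OF Z(3)] by simp
    qed (use finZ in simp)
    \<comment> \<open>The condition on \<open>g\<close> includes the pairs with
      \<open>c = c'\<close>, for which the edge would be a singleton.\<close>
    have noself: "{v} \<notin> E" for v using G by (auto simp: simple_graph_def)
    define g where "g = inv_into S cell"
    have g: "g c \<in> S" "cell (g c) = c" if "c \<in> cell ` Z" for c
      using that im by (auto simp: g_def inv_into_into f_inv_into_f)
    have "{g c, g c'} \<notin> E" if "c \<in> cell ` Z" "c' \<in> cell ` Z" for c c'
      using independent_setD[OF S(1) g(1)[OF that(1)] g(1)[OF that(2)]] noself
      by (cases "g c = g c'") auto
    with g calculation \<open>S \<subseteq> V - Z\<close> show "\<exists>g. ?choice g"
      by (intro exI[of _ g]) blast
  next
    assume "\<exists>g. ?choice g"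
    then obtain g where g: "?choice g" by blast
    let ?S = "g ` cell ` Z"
    have injg: "inj_on g (cell ` Z)" using g by (metis inj_onI)
    have "independent_set V E ?S"
      using g by (auto simp: independent_set_def pairwise_def)
    moreover have "weight w ?S = card Z"
    proof -
      have "weight w ?S = (\<Sum>c\<in>cell ` Z. w (g c))" by (simp add: weight_def sum.reindex[OF injg])
      also have "\<dots> = (\<Sum>c\<in>cell ` Z. 1)" by (rule sum.cong) (use g in auto)
      finally show ?thesis by (simp add: card_image[OF Z(3)])
    qed
    moreover have "?S \<noteq> Z" using g Z(2) by blast
    ultimately show "\<exists>S. independent_set V E S \<and> weight w S = card Z \<and> S \<noteq> Z" by blast
  qed
  with uniq show ?thesis by blast
qed

section \<open>Accepting computations as tables\<close>

type_synonym transition = "(nat \<times> symbol list) \<times> (nat \<times> (symbol \<times> move) list)"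

text \<open>
  An entry \<open>(\<delta>, s, h)\<close> of the cell \<open>(t, i)\<close>: \<open>\<delta>\<close> is the transition taken at time \<open>t\<close>, \<open>s\<close> lists the
  symbols of all the tapes at position \<open>i - T\<close>, and \<open>h\<close> tells which heads are there.
\<close>
type_synonym cell = "transition \<times> symbol list \<times> bool list"

text \<open>
  Loops at the accepting configurations that have halted, so that every accepting computation can be
  continued for ever.
\<close>
definition idles :: "machine \<Rightarrow> transition set" where
  "idles M = (\<lambda>ss. ((accept M, ss), (accept M, map (\<lambda>s. (s, Stay)) ss))) `
     {ss. set ss \<subseteq> machine_symbols M \<and> length ss = tapes M \<and> (\<forall>y. ((accept M, ss), y) \<notin> trans M)}"

text \<open>Kept apart from membership in \<open>trans M\<close>, so that it makes sense for the
  transitions in \<open>idles M\<close> too.\<close>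

definition fires :: "transition \<Rightarrow> config \<Rightarrow> config \<Rightarrow> bool" where
  "fires \<delta> c c' \<longleftrightarrow> fst \<delta> = (fst c, map read (snd c)) \<and> c' = (fst (snd \<delta>), map2 act (snd (snd \<delta>)) (snd c))"

text \<open>By the last condition an entry is consistent in itself: where a head stands, the symbol
  is the one that the transition expects. So reading correctly is a property of single entries and
  needs no edges.\<close>

definition cells :: "machine \<Rightarrow> cell set" where
  "cells M = {(\<delta>, s, h). \<delta> \<in> trans M \<union> idles M \<and> length s = tapes M \<and> set s \<subseteq> machine_symbols M \<and>
     length h = tapes M \<and> (\<forall>j<tapes M. h ! j \<longrightarrow> s ! j = snd (fst \<delta>) ! j)}"

text \<open>The cell containing a head prescribes the presence or absence of that head in every cell
  of the next row, however distant; hence no second head can appear. Symbols are passed on within a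
  column.\<close>

definition follows :: "nat \<Rightarrow> int \<Rightarrow> cell \<Rightarrow> cell \<Rightarrow> bool" where
  "follows k di = (\<lambda>(\<delta>, s, h) (\<delta>', s', h').
     fst (snd \<delta>) = fst (fst \<delta>') \<and>
     (\<forall>j<k. (h ! j \<longrightarrow> (h' ! j \<longleftrightarrow> di = offset (snd (snd (snd \<delta>) ! j)))) \<and>
            (di = 0 \<longrightarrow> s' ! j = (if h ! j then fst (snd (snd \<delta>) ! j) else s ! j))))"

text \<open>All cells of a row repeat the transition and are forced to agree on it. This redundancy
  is what makes every condition on a table a condition on at most two cells, hence expressible by
  edges.\<close>

definition conflict :: "nat \<Rightarrow> int \<Rightarrow> int \<Rightarrow> cell \<Rightarrow> cell \<Rightarrow> bool" where
  "conflict k dt di a b \<longleftrightarrow>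
     dt = 0 \<and> di = 0 \<and> a \<noteq> b \<or> dt = 0 \<and> fst a \<noteq> fst b \<or> dt = 1 \<and> \<not> follows k di a b"

definition initial_cell :: "machine \<Rightarrow> symbol \<Rightarrow> bool \<Rightarrow> cell \<Rightarrow> bool" where
  "initial_cell M b z = (\<lambda>(\<delta>, s, h). fst (fst \<delta>) = start M \<and>
     (\<forall>j<tapes M. s ! j = (if j = 0 then b else Blank) \<and> h ! j = z))"

text \<open>Column \<open>i\<close> stands for position \<open>i - T\<close>, so the heads start in
  column \<open>T\<close>. After \<open>t\<close> steps they are within distance \<open>t\<close>;
  row \<open>T - 1\<close> is the last one in which they are certain to be inside the table, and
  there the computation is required to have halted.\<close>

definition tableau :: "machine \<Rightarrow> bool list \<Rightarrow> nat \<Rightarrow> (nat \<Rightarrow> nat \<Rightarrow> cell) \<Rightarrow> bool" where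
  "tableau M x T f \<longleftrightarrow> (\<forall>t<2*T. \<forall>i<2*T. f t i \<in> cells M \<and>
     (t = 0 \<longrightarrow> initial_cell M (fst (input_tape x) (int i - int T)) (i = T) (f t i)) \<and>
     (Suc t = T \<longrightarrow> fst (f t i) \<in> idles M) \<and>
     (\<forall>t'<2*T. \<forall>i'<2*T. \<not> conflict (tapes M) (int t' - int t) (int i' - int i) (f t i) (f t' i')))"

lemma finite_idles: "wf_machine M \<Longrightarrow> finite (idles M)"
  unfolding idles_def
  by (intro finite_imageI finite_subset[OF _ finite_lists_length_eq[of "machine_symbols M" "tapes M"]])
    (auto simp: finite_machine_symbols)

lemma finite_cells:
  assumes "wf_machine M" shows "finite (cells M)"
proof -
  have "finite ((trans M \<union> idles M) \<times> {s. set s \<subseteq> machine_symbols M \<and> length s = tapes M} \<times>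
      {h. set h \<subseteq> (UNIV :: bool set) \<and> length h = tapes M})"
    using assms finite_idles finite_machine_symbols
    by (intro finite_cartesian_product finite_lists_length_eq) (auto simp: wf_machine_def)
  then show ?thesis by (rule finite_subset[rotated]) (auto simp: cells_def)
qed

lemma trans_lengths:
  assumes "wf_machine M" "\<delta> \<in> trans M \<union> idles M"
  shows "length (snd (fst \<delta>)) = tapes M" "length (snd (snd \<delta>)) = tapes M"
  using assms by (auto simp: wf_machine_def idles_def)

lemma step_iff_fires: "step M c c' \<longleftrightarrow> (\<exists>\<delta>\<in>trans M. fires \<delta> c c')"
  by (cases c; cases c') (force simp: step_def fires_def)

lemma fires_idle:
  assumes "\<delta> \<in> idles M" "fires \<delta> c c'"
  shows "c' = c"
proof -
  have "map2 act (map (\<lambda>s. (s, Stay)) (map read ts)) ts = ts" for ts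
    by (rule nth_equalityI) (auto simp: act_def read_def)
  then show ?thesis using assms unfolding fires_def idles_def by (cases c) auto
qed

text \<open>The transitions of the rows, applied one after another to the initial configuration,
  define the sequence \<open>c\<close>. By induction row \<open>t\<close> describes
  \<open>c t\<close>, for \<open>t < T\<close>; the bound on the head positions in
  \<open>matches\<close> keeps the heads inside the table.\<close>

lemma tableau_accepts:
  assumes M: "wf_machine M" and T: "T \<ge> 1" and f: "tableau M x T f"
  shows "accepts M x"
proof -
  let ?k = "tapes M"
  define \<delta> where "\<delta> t = fst (f t 0)" for t
  define c where "c = rec_nat (initial M x) (\<lambda>t c. (fst (snd (\<delta> t)), map2 act (snd (snd (\<delta> t))) (snd c)))"
  have c0: "c 0 = initial M x" by (simp add: c_def)
  have cS: "c (Suc t) = (fst (snd (\<delta> t)), map2 act (snd (snd (\<delta> t))) (snd (c t)))" for t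
    by (simp add: c_def)
  have cells: "f t i \<in> cells M" if "t < 2*T" "i < 2*T" for t i
    using f that by (auto simp: tableau_def)
  have noconf: "\<not> conflict ?k (int t' - int t) (int i' - int i) (f t i) (f t' i')"
    if "t < 2*T" "i < 2*T" "t' < 2*T" "i' < 2*T" for t i t' i'
    using f that by (auto simp: tableau_def)
  have \<delta>: "fst (f t i) = \<delta> t" if "t < 2*T" "i < 2*T" for t i
    using noconf[of t 0 t i] that T by (auto simp: conflict_def \<delta>_def)
  define s where "s t i = fst (snd (f t i))" for t i
  define h where "h t i = snd (snd (f t i))" for t i
  have f_eq: "f t i = (\<delta> t, s t i, h t i)" if "t < 2*T" "i < 2*T" for t i
    using \<delta>[OF that] by (simp add: s_def h_def prod_eq_iff)
  have \<delta>in: "\<delta> t \<in> trans M \<union> idles M" if "t < 2*T" for t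
    using cells[of t 0] f_eq[of t 0] that T by (auto simp: cells_def)
  note len = trans_lengths[OF M \<delta>in]
  have fol: "follows ?k (int i' - int i) (\<delta> t, s t i, h t i) (\<delta> (Suc t), s (Suc t) i', h (Suc t) i')"
    if "Suc t < 2*T" "i < 2*T" "i' < 2*T" for t i i'
    using noconf[of t i "Suc t" i'] that f_eq[of t i] f_eq[of "Suc t" i'] by (auto simp: conflict_def)
  define matches where "matches t \<longleftrightarrow> length (snd (c t)) = ?k \<and> fst (c t) = fst (fst (\<delta> t)) \<and>
    (\<forall>j<?k. \<bar>snd (snd (c t) ! j)\<bar> \<le> int t \<and> (\<forall>i<2*T. s t i ! j = fst (snd (c t) ! j) (int i - int T) \<and>
       (h t i ! j \<longleftrightarrow> snd (snd (c t) ! j) = int i - int T)))" for t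
  have pos: "\<exists>i<2*T. snd (snd (c t) ! j) = int i - int T" if "matches t" "t < T" "j < ?k" for t j
    using that by (intro exI[of _ "nat (snd (snd (c t) ! j) + int T)"]) (auto simp: matches_def abs_le_iff)
  have fire: "fires (\<delta> t) (c t) (c (Suc t))" if "matches t" "t < T" for t
  proof -
    have t: "t < 2*T" using that by simp
    have "read (snd (c t) ! j) = snd (fst (\<delta> t)) ! j" if j: "j < ?k" for j
    proof -
      obtain i where i: "i < 2*T" "snd (snd (c t) ! j) = int i - int T"
        using pos[OF \<open>matches t\<close> \<open>t < T\<close> j] by blast
      then have "h t i ! j" "s t i ! j = fst (snd (c t) ! j) (int i - int T)"
        using \<open>matches t\<close> j by (auto simp: matches_def)
      moreover have "h t i ! j \<longrightarrow> s t i ! j = snd (fst (\<delta> t)) ! j"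
        using cells[OF t i(1)] f_eq[OF t i(1)] j by (auto simp: cells_def)
      ultimately show ?thesis using i by (simp add: read_def)
    qed
    then have "map read (snd (c t)) = snd (fst (\<delta> t))"
      using that len[OF t] by (intro nth_equalityI) (auto simp: matches_def)
    then show ?thesis using that cS by (simp add: fires_def matches_def prod_eq_iff)
  qed
  have m: "matches t" if "t < T" for t
    using that
  proof (induction t)
    case 0
    have "initial_cell M (fst (input_tape x) (int i - int T)) (i = T) (\<delta> 0, s 0 i, h 0 i)" if "i < 2*T" for i
      using f[unfolded tableau_def, rule_format, of 0 i] f_eq[of 0 i] that 0 by simp
    then have "\<forall>i<2*T. fst (fst (\<delta> 0)) = start M \<and>
      (\<forall>j<tapes M. s 0 i ! j = (if j = 0 then (fst (input_tape x) (int i - int T)) else Blank) \<and> h 0 i ! j = (i = T))"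
      by (auto simp: initial_cell_def)
    moreover from this have "start M = fst (fst (\<delta> 0))" using T by (metis less_numeral_extra(1) mult_pos_pos order_less_le_trans zero_less_numeral)
    ultimately show ?case
      using 0 M by (auto simp: matches_def c0 initial_def wf_machine_def nth_Cons' input_tape_def blank_tape_def)
  next
    case (Suc t)
    then have mt: "matches t" and t: "Suc t < 2*T" "t < 2*T" by auto
    have "fst (c (Suc t)) = fst (fst (\<delta> (Suc t)))"
      using fol[of t 0 0] t Suc.prems by (auto simp: cS follows_def)
    moreover have "length (snd (c (Suc t))) = ?k"
      using mt len[OF t(2)] by (simp add: cS matches_def)
    moreover have "\<bar>snd (snd (c (Suc t)) ! j)\<bar> \<le> int (Suc t) \<and>
       (\<forall>i<2*T. s (Suc t) i ! j = fst (snd (c (Suc t)) ! j) (int i - int T) \<and>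
       (h (Suc t) i ! j \<longleftrightarrow> snd (snd (c (Suc t)) ! j) = int i - int T))" if j: "j < ?k" for j
    proof -
      define p where "p = snd (snd (c t) ! j)"
      define a where "a = snd (snd (\<delta> t)) ! j"
      obtain i0 where i0: "i0 < 2*T" "p = int i0 - int T"
        using pos[OF mt _ j] Suc.prems by (auto simp: p_def)
      have h0: "h t i0 ! j" using mt i0 j by (auto simp: matches_def p_def)
      have cj: "snd (c (Suc t)) ! j = ((fst (snd (c t) ! j))(p := fst a), p + offset (snd a))"
        using j mt len[OF t(2)] by (simp add: cS act_def p_def a_def matches_def)
      have "\<bar>p\<bar> \<le> int t" using mt j by (auto simp: matches_def p_def)
      then have "\<bar>p + offset (snd a)\<bar> \<le> int (Suc t)"
        by (cases "snd a") auto
      moreover have "s (Suc t) i ! j = ((fst (snd (c t) ! j))(p := fst a)) (int i - int T)" if "i < 2*T" for i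
      proof -
        have "s (Suc t) i ! j = (if h t i ! j then fst a else s t i ! j)"
          using fol[OF t(1) that that] j by (auto simp: follows_def a_def)
        then show ?thesis using mt j that by (auto simp: matches_def p_def)
      qed
      \<comment> \<open>All columns of the next row are compared with the one column
        \<open>i0\<close> that contained the head.\<close>
      moreover have "h (Suc t) i ! j \<longleftrightarrow> p + offset (snd a) = int i - int T" if "i < 2*T" for i
        using fol[OF t(1) i0(1) that] h0 j i0(2) by (auto simp: follows_def a_def)
      ultimately show ?thesis by (simp add: cj)
    qed
    ultimately show ?case unfolding matches_def by blast
  qed
  have "\<delta> (T - 1) \<in> idles M"
    using f T by (auto simp: tableau_def \<delta>_def)
  \<comment> \<open>Up to the first idle row only transitions of \<open>M\<close> are used, so
    \<open>c t0\<close> is reached by genuine steps. An idle transition exists only where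
    \<open>M\<close> has none in the accepting state, so \<open>M\<close> has halted there.\<close>
  define t0 where "t0 = (LEAST t. \<delta> t \<in> idles M)"
  have t0: "\<delta> t0 \<in> idles M" "t0 \<le> T - 1"
    unfolding t0_def using \<open>\<delta> (T - 1) \<in> idles M\<close> by (rule LeastI, rule Least_le)
  have lt: "\<delta> t \<in> trans M" if "t < t0" for t
    using \<delta>in[of t] not_less_Least[of t "\<lambda>t. \<delta> t \<in> idles M"] that t0(2) T by (auto simp: t0_def)
  have "(step M)\<^sup>*\<^sup>* (initial M x) (c t)" if "t \<le> t0" for t
    using that
  proof (induction t)
    case (Suc t)
    then have "step M (c t) (c (Suc t))"
      using fire[OF m, of t] lt[of t] t0 T unfolding step_iff_fires by force
    with Suc show ?case by (simp add: rtranclp.rtrancl_into_rtrancl)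
  qed (simp add: c0)
  moreover have "fires (\<delta> t0) (c t0) (c (Suc t0))"
    by (rule fire[OF m]) (use t0 T in auto)
  then have "halted M (c t0) \<and> fst (c t0) = accept M"
    using t0(1) by (auto simp: halted_def step_def fires_def idles_def)
  ultimately show ?thesis unfolding accepts_def by blast
qed

text \<open>The computation is prolonged by repeating its last configuration, with idle transitions.
  It ends before time \<open>T\<close> by the time bound, so row \<open>T - 1\<close> is
  idle.\<close>

lemma accepts_tableau:
  assumes M: "wf_machine M" and dec: "decides_in_time M p L" and acc: "accepts M x" and T: "p (length x) < T"
  shows "\<exists>f. tableau M x T f"
proof -
  let ?k = "tapes M" and ?X = "machine_symbols M"
  obtain e m where e: "(step M ^^ m) (initial M x) e" "halted M e" "fst e = accept M"
    using acc unfolding accepts_def by (auto simp: rtranclp_power)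
  have "m < T" using dec e(1) T unfolding decides_in_time_def by (meson le_less_trans)
  obtain c0 where c0: "c0 0 = initial M x" "c0 m = e" "\<And>i. i < m \<Longrightarrow> step M (c0 i) (c0 (Suc i))"
    using e(1) by (auto simp: relpowp_fun_conv)
  define c where "c t = c0 (min t m)" for t
  have c_init: "c 0 = initial M x" by (simp add: c_def c0)
  \<comment> \<open>\<open>cells M\<close> and \<open>idles M\<close> admit only words over
    \<open>machine_symbols M\<close>, so the tapes have to be shown to contain nothing else.\<close>
  define I where "I c \<longleftrightarrow> length (snd c) = ?k \<and> (\<forall>j<?k. \<forall>p. fst (snd c ! j) p \<in> ?X)" for c :: config
  have I_step: "I d'" if "I d" "\<delta> \<in> trans M" "fires \<delta> d d'" for \<delta> d d'
  proof -
    have len: "length (snd (snd \<delta>)) = ?k" using trans_lengths[OF M] that(2) by blast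
    have "fst (snd (snd \<delta>) ! j) \<in> ?X" if "j < ?k" for j
      using \<open>\<delta> \<in> trans M\<close> len that unfolding machine_symbols_def
      by (auto intro!: bexI[OF _ \<open>\<delta> \<in> trans M\<close>] split: prod.splits)
    then show ?thesis using that len by (auto simp: I_def fires_def act_def)
  qed
  have I_c: "I (c t)" for t
  proof (induction t)
    case 0
    then show ?case using M
      by (auto simp: c_init I_def initial_def wf_machine_def nth_Cons' input_tape_def blank_tape_def machine_symbols_def)
  next
    case (Suc t)
    show ?case
    proof (cases "t < m")
      case True
      then show ?thesis
        using c0(3)[of t] Suc I_step[of "c0 t" _ "c0 (Suc t)"] by (auto simp: c_def step_iff_fires)
    next
      case False
      then show ?thesis using Suc by (simp add: c_def min_absorb2)
    qed
  qed
  have "\<exists>\<delta>. \<delta> \<in> trans M \<union> idles M \<and> fires \<delta> (c t) (c (Suc t)) \<and> (m \<le> t \<longrightarrow> \<delta> \<in> idles M)" for t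
  proof (cases "t < m")
    case True
    then show ?thesis using c0(3)[of t] by (auto simp: c_def step_iff_fires)
  next
    case False
    then have ct: "c t = e" "c (Suc t) = e" by (auto simp: c_def c0 min_def)
    let ?ss = "map read (snd e)"
    let ?\<delta> = "((accept M, ?ss), (accept M, map (\<lambda>s. (s, Stay)) ?ss))"
    have "set ?ss \<subseteq> ?X" using I_c[of t] by (fastforce simp: ct I_def read_def in_set_conv_nth)
    moreover have "((accept M, ?ss), y) \<notin> trans M" for y
      using e(2,3) by (cases y) (auto simp: halted_def step_def)
    ultimately have "?\<delta> \<in> idles M"
      using I_c[of t] unfolding idles_def ct by (intro image_eqI[of _ _ ?ss]) (auto simp: I_def)
    moreover have "fires ?\<delta> e (accept M, map2 act (map (\<lambda>s. (s, Stay)) ?ss) (snd e))"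
      using e(3) by (simp add: fires_def)
    moreover from fires_idle[OF calculation] have "fires ?\<delta> e e"
      using calculation(2) by simp
    ultimately show ?thesis unfolding ct by blast
  qed
  then obtain \<delta> where \<delta>: "\<And>t. \<delta> t \<in> trans M \<union> idles M" "\<And>t. fires (\<delta> t) (c t) (c (Suc t))"
    "\<And>t. m \<le> t \<Longrightarrow> \<delta> t \<in> idles M"
    by metis
  have len: "length (snd (c t)) = ?k" for t using I_c by (simp add: I_def)
  note len\<delta> = trans_lengths[OF M \<delta>(1)]
  define f where "f t i = (\<delta> t, map (\<lambda>b. fst b (int i - int T)) (snd (c t)), map (\<lambda>b. snd b = int i - int T) (snd (c t)))"
    for t i
  have src: "fst (\<delta> t) = (fst (c t), map read (snd (c t)))" for t
    using \<delta>(2) by (simp add: fires_def)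
  have nxt: "fst (c (Suc t)) = fst (snd (\<delta> t))" "j < ?k \<Longrightarrow> snd (c (Suc t)) ! j = act (snd (snd (\<delta> t)) ! j) (snd (c t) ! j)" for t j
    using \<delta>(2)[of t] len len\<delta> by (auto simp: fires_def)
  have "set (map (\<lambda>b. fst b p) (snd (c t))) \<subseteq> ?X" for t p
    using I_c[of t] by (fastforce simp: I_def in_set_conv_nth)
  then have "f t i \<in> cells M" for t i
    using \<delta>(1)[of t] len I_c[of t] src[of t] by (auto simp: cells_def f_def read_def)
  moreover have "initial_cell M (fst (input_tape x) (int i - int T)) (i = T) (f 0 i)" for i
    using src[of 0] len[of 0] by (auto simp: initial_cell_def f_def c_init initial_def nth_Cons' input_tape_def blank_tape_def)
  moreover have "fst (f t i) \<in> idles M" if "Suc t = T" for t i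
    using \<delta>(3)[of t] \<open>m < T\<close> that by (simp add: f_def)
  moreover have "\<not> conflict ?k (int t' - int t) (int i' - int i) (f t i) (f t' i')" for t i t' i'
  proof -
    have "follows ?k (int i' - int i) (f t i) (f (Suc t) i')"
      using nxt(1)[of t] nxt(2)[of _ t] src[of "Suc t"] len by (auto simp: follows_def f_def act_def)
    moreover have "int t' - int t = 1 \<longleftrightarrow> t' = Suc t" "int t' - int t = 0 \<longleftrightarrow> t' = t" "int i' - int i = 0 \<longleftrightarrow> i' = i"
      by linarith+
    ultimately show ?thesis unfolding conflict_def by (auto simp: f_def)
  qed
  ultimately have "tableau M x T f" by (auto simp: tableau_def)
  then show ?thesis by blast
qed

section \<open>The weighted graph of all possible tables\<close>

fun adjacent :: "nat \<Rightarrow> int \<Rightarrow> int \<Rightarrow> cell option \<Rightarrow> cell option \<Rightarrow> bool" where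
  "adjacent k dt di None None = False"
| "adjacent k dt di None (Some b) = True"
| "adjacent k dt di (Some a) None = True"
| "adjacent k dt di (Some a) (Some b) = (conflict k dt di a b \<or> conflict k (- dt) (- di) b a)"

text \<open>The cell matters only through one input symbol and three flags: just what four heads
  show when the weight is written.\<close>

fun cell_weight :: "machine \<Rightarrow> symbol \<Rightarrow> bool \<Rightarrow> bool \<Rightarrow> bool \<Rightarrow> cell option \<Rightarrow> nat" where
  "cell_weight M b z beg fin None = 1"
| "cell_weight M b z beg fin (Some a) =
     of_bool ((beg \<longrightarrow> initial_cell M b z a) \<and> (fin \<longrightarrow> fst a \<in> idles M))"

text \<open>Vertex \<open>(t * D + i) * m + j\<close> stands for entry number \<open>j\<close> of
  cell \<open>(t, i)\<close>, where \<open>m\<close> is the number of entries. In this numbering the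
  vertices are listed in increasing order by nested loops over \<open>t\<close>, \<open>i\<close>
  and the entries.\<close>

definition time_of :: "nat \<Rightarrow> nat \<Rightarrow> nat \<Rightarrow> nat" where "time_of D m v = v div m div D"
definition pos_of :: "nat \<Rightarrow> nat \<Rightarrow> nat \<Rightarrow> nat" where "pos_of D m v = v div m mod D"

definition tableau_weight :: "machine \<Rightarrow> cell option list \<Rightarrow> bool list \<Rightarrow> nat \<Rightarrow> nat \<Rightarrow> nat" where
  "tableau_weight M F x T v =
     (let t = time_of (2*T) (length F) v; i = pos_of (2*T) (length F) v
      in cell_weight M (fst (input_tape x) (int i - int T)) (i = T) (t = 0) (Suc t = T) (F ! (v mod length F)))"

definition tableau_adjacent :: "nat \<Rightarrow> cell option list \<Rightarrow> nat \<Rightarrow> nat \<Rightarrow> nat \<Rightarrow> bool" where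
  "tableau_adjacent k F D u v =
     adjacent k (int (time_of D (length F) v) - int (time_of D (length F) u))
       (int (pos_of D (length F) v) - int (pos_of D (length F) u))
       (F ! (u mod length F)) (F ! (v mod length F))"

definition tableau_edges :: "nat \<Rightarrow> cell option list \<Rightarrow> nat \<Rightarrow> nat set set" where
  "tableau_edges k F D =
     {{u, v} | u v. u < D * D * length F \<and> v < D * D * length F \<and> tableau_adjacent k F D u v}"

text \<open>\<open>conflict\<close> looks from a row to the next one; \<open>adjacent\<close> takes
  both directions, with the differences negated.\<close>

lemma adjacent_sym: "adjacent k dt di a b \<longleftrightarrow> adjacent k (- dt) (- di) b a"
  by (cases a; cases b) auto

lemma tableau_adjacent_sym: "tableau_adjacent k F D u v \<longleftrightarrow> tableau_adjacent k F D v u"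
  unfolding tableau_adjacent_def using adjacent_sym[of k _ _ "F ! (u mod length F)"]
  by (metis minus_diff_eq)

lemma tableau_adjacent_irrefl: "\<not> tableau_adjacent k F D u u"
  unfolding tableau_adjacent_def by (cases "F ! (u mod length F)") (auto simp: conflict_def)

lemma tableau_edges_iff:
  assumes "u < D * D * length F" "v < D * D * length F"
  shows "{u, v} \<in> tableau_edges k F D \<longleftrightarrow> tableau_adjacent k F D u v"
  using assms tableau_adjacent_sym unfolding tableau_edges_def by (auto simp: doubleton_eq_iff)

lemma simple_tableau_graph: "simple_graph {..<D * D * length F} (tableau_edges k F D)"
proof -
  have "e \<subseteq> {..<D * D * length F} \<and> card e = 2" if e: "e \<in> tableau_edges k F D" for e
  proof -
    obtain u v where e: "e = {u, v}" "u < D * D * length F" "v < D * D * length F" "tableau_adjacent k F D u v"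
      using e unfolding tableau_edges_def by blast
    then have "u \<noteq> v" using tableau_adjacent_irrefl by blast
    with e show ?thesis by auto
  qed
  then show ?thesis by (auto simp: simple_graph_def)
qed

lemma vertex_bounds:
  fixes D m t i j :: nat
  assumes "t < D" "i < D" "j < m"
  shows "(t * D + i) * m + j < D * D * m"
proof -
  have "t * D + i < D * D"
    using assms mult_le_mono1[of "Suc t" D D] by simp
  then have "Suc (t * D + i) * m \<le> D * D * m" by (intro mult_le_mono1) simp
  then show ?thesis using assms by simp
qed

text \<open>An instance of \<open>unique_mwis_with_fallback\<close>, with \<open>Z\<close> the
  vertices whose entry is \<open>None\<close>: a choice of one entry of weight 1 per cell without
  edges is a table. As \<open>F\<close> is distinct, two vertices of one cell carry different
  entries and are therefore in conflict.\<close>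

lemma tableau_graph_correct:
  assumes T: "T \<ge> 1" and F: "set F = insert None (Some ` cells M)" "distinct F"
  shows "has_unique_mwis {..<2*T * (2*T) * length F} (tableau_edges (tapes M) F (2*T)) (tableau_weight M F x T)
    \<longleftrightarrow> \<not> (\<exists>f. tableau M x T f)"
proof -
  define D where "D = 2 * T"
  define m where "m = length F"
  define N where "N = D * D * m"
  have D: "D \<ge> 1" using T by (simp add: D_def)
  have m: "m \<ge> 1" using F by (cases F) (auto simp: m_def)
  define cell where "cell v = (time_of D m v, pos_of D m v)" for v
  define val where "val v = F ! (v mod m)" for v
  define vtx where "vtx = (\<lambda>(t, i) j. (t * D + i) * m + j)"
  have vtx: "vtx (t, i) j < N" "cell (vtx (t, i) j) = (t, i)" "val (vtx (t, i) j) = F ! j"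
    if "t < D" "i < D" "j < m" for t i j
    using that vertex_bounds[OF that] by (auto simp: vtx_def N_def cell_def val_def time_of_def pos_of_def)
  have v_vtx: "v = vtx (cell v) (v mod m)" "fst (cell v) < D" "snd (cell v) < D" "v mod m < m"
    if "v < N" for v
  proof -
    show "v = vtx (cell v) (v mod m)"
      by (simp add: vtx_def cell_def time_of_def pos_of_def)
    show "snd (cell v) < D" "v mod m < m" using D m by (auto simp: cell_def pos_of_def)
    show "fst (cell v) < D" using that
      by (simp add: cell_def time_of_def N_def less_mult_imp_div_less)
  qed
  have F_in: "val v \<in> insert None (Some ` cells M)" for v
    unfolding val_def F(1)[symmetric] by (rule nth_mem) (use m in \<open>auto simp: m_def Suc_le_eq\<close>)
  have idx: "\<exists>j<m. F ! j = a" if "a \<in> insert None (Some ` cells M)" for a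
    using that F(1) by (metis in_set_conv_nth m_def)
  obtain j0 where j0: "j0 < m" "F ! j0 = None" using idx[of None] by auto
  define Z where "Z = {v. v < N \<and> val v = None}"
  let ?E = "tableau_edges (tapes M) F D" and ?w = "tableau_weight M F x T" and ?V = "{..<N}"
  have same: "u = v" if "u < N" "v < N" "cell u = cell v" "val u = val v" for u v
  proof -
    have "u mod m = v mod m"
      using that(4) F(2) v_vtx(4)[OF that(1)] v_vtx(4)[OF that(2)]
      by (simp add: val_def m_def nth_eq_iff_index_eq)
    then show ?thesis using v_vtx(1)[OF that(1)] v_vtx(1)[OF that(2)] that(3) by metis
  qed
  have E: "{u, v} \<in> ?E \<longleftrightarrow> adjacent (tapes M) (int (fst (cell v)) - int (fst (cell u)))
      (int (snd (cell v)) - int (snd (cell u))) (val u) (val v)" if "u < N" "v < N" for u v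
    using tableau_edges_iff[of u D F v] that unfolding N_def m_def tableau_adjacent_def cell_def val_def by simp
  have cellZ: "cell ` Z = {..<D} \<times> {..<D}"
  proof
    show "cell ` Z \<subseteq> {..<D} \<times> {..<D}"
      using v_vtx(2,3) by (simp add: Z_def mem_Times_iff image_subset_iff)
    show "{..<D} \<times> {..<D} \<subseteq> cell ` Z"
    proof
      fix c assume "c \<in> {..<D} \<times> {..<D}"
      then obtain t i where c: "c = (t, i)" "t < D" "i < D" by auto
      then show "c \<in> cell ` Z"
        using vtx[OF c(2,3) j0(1)] j0(2) by (intro image_eqI[of _ _ "vtx (t, i) j0"]) (auto simp: Z_def)
    qed
  qed
  have "has_unique_mwis ?V ?E ?w \<longleftrightarrow>
    \<not> (\<exists>g. \<forall>c\<in>cell ` Z. g c \<in> ?V - Z \<and> cell (g c) = c \<and> ?w (g c) = 1 \<and> (\<forall>c'\<in>cell ` Z. {g c, g c'} \<notin> ?E))"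
  proof (rule unique_mwis_with_fallback)
    show "simple_graph ?V ?E" using simple_tableau_graph by (simp add: N_def m_def)
    show "?w v \<le> 1" for v
      unfolding tableau_weight_def Let_def by (cases "F ! (v mod length F)") auto
    show "Z \<subseteq> ?V" by (auto simp: Z_def)
    have "(0, 0) \<in> cell ` Z" unfolding cellZ using D by simp
    then show "Z \<noteq> {}" by blast
    show "inj_on cell Z" by (rule inj_onI, rule same) (auto simp: Z_def)
    show "cell ` ?V \<subseteq> cell ` Z" unfolding cellZ using v_vtx(2,3) by (simp add: mem_Times_iff image_subset_iff)
    show "?w v = 1" if "v \<in> Z" for v
      using that by (auto simp: Z_def tableau_weight_def Let_def val_def m_def)
    show "{u, v} \<notin> ?E" if "u \<in> Z" "v \<in> Z" for u v
      using that E by (auto simp: Z_def)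
    show "{u, v} \<in> ?E" if "u \<in> Z" "v \<in> ?V - Z" for u v
      using that E by (auto simp: Z_def)
    show "{u, v} \<in> ?E" if "u \<in> ?V - Z" "v \<in> ?V - Z" "u \<noteq> v" "cell u = cell v" for u v
    proof -
      have "val u \<noteq> None" "val v \<noteq> None" using that by (auto simp: Z_def)
      then obtain a b where ab: "val u = Some a" "val v = Some b" by blast
      with same that have "a \<noteq> b" by auto
      then show ?thesis using that E ab by (auto simp: conflict_def)
    qed
  qed
  also have "(\<exists>g. \<forall>c\<in>cell ` Z. g c \<in> ?V - Z \<and> cell (g c) = c \<and> ?w (g c) = 1 \<and> (\<forall>c'\<in>cell ` Z. {g c, g c'} \<notin> ?E))
     \<longleftrightarrow> (\<exists>f. tableau M x T f)"
  proof
    assume "\<exists>g. \<forall>c\<in>cell ` Z. g c \<in> ?V - Z \<and> cell (g c) = c \<and> ?w (g c) = 1 \<and> (\<forall>c'\<in>cell ` Z. {g c, g c'} \<notin> ?E)"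
    then obtain g where g: "\<And>t i. t < D \<Longrightarrow> i < D \<Longrightarrow> g (t, i) < N \<and> g (t, i) \<notin> Z \<and> cell (g (t, i)) = (t, i) \<and> ?w (g (t, i)) = 1"
      "\<And>t i t' i'. t < D \<Longrightarrow> i < D \<Longrightarrow> t' < D \<Longrightarrow> i' < D \<Longrightarrow> {g (t, i), g (t', i')} \<notin> ?E"
      unfolding cellZ by fastforce
    define f where "f t i = the (val (g (t, i)))" for t i
    have f: "val (g (t, i)) = Some (f t i)" "f t i \<in> cells M" if "t < D" "i < D" for t i
      using g(1)[OF that] F_in[of "g (t, i)"] by (auto simp: f_def Z_def)
    have noconf: "\<not> conflict (tapes M) (int t' - int t) (int i' - int i) (f t i) (f t' i')"
      if "t < D" "i < D" "t' < D" "i' < D" for t i t' i'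
      using g(2)[OF that] E[of "g (t, i)" "g (t', i')"] g(1) f that by auto
    have weight: "?w (g (t, i)) = cell_weight M (fst (input_tape x) (int i - int T)) (i = T) (t = 0) (Suc t = T) (Some (f t i))"
      if "t < D" "i < D" for t i
      using f(1)[OF that] g(1)[OF that]
      by (simp add: tableau_weight_def val_def m_def D_def cell_def Let_def)
    have "(t = 0 \<longrightarrow> initial_cell M (fst (input_tape x) (int i - int T)) (i = T) (f t i)) \<and>
        (Suc t = T \<longrightarrow> fst (f t i) \<in> idles M)" if "t < D" "i < D" for t i
    proof -
      have "?w (g (t, i)) = 1" using g(1)[OF that] by blast
      then show ?thesis unfolding weight[OF that] cell_weight.simps of_bool_eq_1_iff .
    qed
    then have "tableau M x T f"
      using f(2) noconf unfolding tableau_def D_def[symmetric] by (intro allI impI conjI; blast)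
    then show "\<exists>f. tableau M x T f" by blast
  next
    assume "\<exists>f. tableau M x T f"
    then obtain f where f: "tableau M x T f" by blast
    have "\<forall>t i. \<exists>j. t < D \<longrightarrow> i < D \<longrightarrow> j < m \<and> F ! j = Some (f t i)"
      using f idx unfolding tableau_def D_def[symmetric] by (metis imageI insertCI)
    then obtain J where J: "\<And>t i. t < D \<Longrightarrow> i < D \<Longrightarrow> J t i < m \<and> F ! J t i = Some (f t i)"
      by metis
    define g where "g = (\<lambda>(t, i). vtx (t, i) (J t i))"
    have g: "g (t, i) < N" "cell (g (t, i)) = (t, i)" "val (g (t, i)) = Some (f t i)" if "t < D" "i < D" for t i
      using vtx[OF that] J[OF that] by (auto simp: g_def)
    have "?w (g (t, i)) = cell_weight M (fst (input_tape x) (int i - int T)) (i = T) (t = 0) (Suc t = T) (Some (f t i))"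
      if "t < D" "i < D" for t i
      using g[OF that] by (simp add: tableau_weight_def val_def m_def D_def cell_def Let_def)
    moreover have "{g (t, i), g (t', i')} \<notin> ?E" if "t < D" "i < D" "t' < D" "i' < D" for t i t' i'
      using E[of "g (t, i)" "g (t', i')"] g[OF that(1,2)] g[OF that(3,4)] f that
      unfolding tableau_def D_def[symmetric] by auto
    moreover have "g (t, i) \<notin> Z" if "t < D" "i < D" for t i
      using g(3)[OF that] by (simp add: Z_def)
    ultimately have "\<forall>c\<in>cell ` Z. g c \<in> ?V - Z \<and> cell (g c) = c \<and> ?w (g c) = 1 \<and> (\<forall>c'\<in>cell ` Z. {g c, g c'} \<notin> ?E)"
      using f g(1,2) unfolding cellZ tableau_def D_def[symmetric] by auto
    then show "\<exists>g. \<forall>c\<in>cell ` Z. g c \<in> ?V - Z \<and> cell (g c) = c \<and> ?w (g c) = 1 \<and> (\<forall>c'\<in>cell ` Z. {g c, g c'} \<notin> ?E)"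
      by blast
  qed
  finally show ?thesis by (simp add: N_def D_def m_def)
qed

section \<open>Writing the graph\<close>

primrec seqs :: "cmd list \<Rightarrow> cmd" where
  "seqs [] = Skip"
| "seqs (c # cs) = Seq c (seqs cs)"

fun opposite :: "move \<Rightarrow> move" where
  "opposite MoveLeft = MoveRight"
| "opposite Stay = Stay"
| "opposite MoveRight = MoveLeft"

lemma offset_opposite [simp]: "offset (opposite m) = - offset m"
  by (cases m) auto

definition moves :: "(nat \<Rightarrow> move) \<Rightarrow> effect" where
  "moves mv = (\<lambda>n. (None, mv n))"

definition moves_back :: "(nat \<Rightarrow> move) \<Rightarrow> effect" where
  "moves_back mv = (\<lambda>n. (None, opposite (mv n)))"

definition shift :: "(nat \<Rightarrow> move) \<Rightarrow> int \<Rightarrow> store \<Rightarrow> store" where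
  "shift mv z \<sigma> = (\<lambda>n. (fst (\<sigma> n), snd (\<sigma> n) + z * offset (mv n)))"

lemma apply_moves [simp]: "apply_effect (moves mv) \<sigma> = shift mv 1 \<sigma>"
  by (simp add: apply_effect_def moves_def shift_def)

lemma apply_moves_back [simp]: "apply_effect (moves_back mv) \<sigma> = shift mv (- 1) \<sigma>"
  by (simp add: apply_effect_def moves_back_def shift_def)

lemma shift_shift: "shift mv a (shift mv b \<sigma>) = shift mv (a + b) \<sigma>"
  by (simp add: shift_def algebra_simps)

lemma shift_0 [simp]: "shift mv 0 \<sigma> = \<sigma>"
  by (simp add: shift_def)

text \<open>Head \<open>j\<close> starts just behind a non-blank block and ends on its first cell.
  The loop stops only on the blank before the block, hence the final step to the right.\<close>

definition rewind :: "nat \<Rightarrow> (nat \<Rightarrow> move) \<Rightarrow> cmd" where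
  "rewind j mv = Seq (Act (moves_back mv)) (Seq (While j (Act (moves_back mv))) (Act (moves mv)))"

text \<open>
  The bound variable of the loop is the position of head \<open>j\<close>; it runs over a block of non-blank
  cells, and the heads moving along with it are finally put back.
\<close>
definition For :: "nat \<Rightarrow> (nat \<Rightarrow> move) \<Rightarrow> cmd \<Rightarrow> cmd" where
  "For j mv body = Seq (While j (Seq body (Act (moves mv)))) (rewind j mv)"

lemma runs_While_back:
  assumes "mv j = MoveRight" "\<And>i. p - int len < i \<Longrightarrow> i \<le> p \<Longrightarrow> r i \<noteq> Blank" "r (p - int len) = Blank"
    "\<sigma> j = (r, p)"
  shows "runs (While j (Act (moves_back mv))) \<sigma> (2 * len + 1) (shift mv (- int len) \<sigma>)"
  using assms(2-)
proof (induction len arbitrary: \<sigma> p)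
  case 0
  then show ?case using runs_While_False[of \<sigma> j] by (simp add: reads_def read_def)
next
  case (Suc len)
  have "runs (While j (Act (moves_back mv))) (shift mv (- 1) \<sigma>) (2 * len + 1) (shift mv (- int len) (shift mv (- 1) \<sigma>))"
    by (rule Suc.IH[of "p - 1"]) (use Suc.prems assms(1) in \<open>auto simp: shift_def algebra_simps\<close>)
  moreover have "reads \<sigma> j \<noteq> Blank" using Suc.prems by (simp add: reads_def read_def)
  moreover have "runs (Act (moves_back mv)) \<sigma> 1 (shift mv (- 1) \<sigma>)" using runs_Act[of "moves_back mv" \<sigma>] by simp
  ultimately have "runs (While j (Act (moves_back mv))) \<sigma> (1 + (2 * len + 1) + 1) (shift mv (- int len) (shift mv (- 1) \<sigma>))"
    by (intro runs_While_True)
  then show ?case by (rule runs_weaken) (simp_all add: shift_shift algebra_simps)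
qed

lemma runs_rewind:
  assumes "mv j = MoveRight" "\<And>i. p - int len \<le> i \<Longrightarrow> i < p \<Longrightarrow> r i \<noteq> Blank" "r (p - int len - 1) = Blank"
    "\<sigma> j = (r, p)"
  shows "runs (rewind j mv) \<sigma> (2 * len + 5) (shift mv (- int len) \<sigma>)"
proof -
  have "runs (While j (Act (moves_back mv))) (shift mv (- 1) \<sigma>) (2 * len + 1) (shift mv (- int len) (shift mv (- 1) \<sigma>))"
    by (rule runs_While_back[of _ _ "p - 1"]) (use assms in \<open>auto simp: shift_def algebra_simps\<close>)
  from runs_Seq[OF runs_Act[of "moves_back mv" \<sigma>, unfolded apply_moves_back] runs_Seq[OF this runs_Act[of "moves mv"]]]
  show ?thesis unfolding rewind_def by (rule runs_weaken) (simp_all add: shift_shift)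
qed

lemma runs_While_forward:
  assumes "\<And>k. k < len \<Longrightarrow> runs body (S k) b (U k)" "\<And>k. k < len \<Longrightarrow> S (Suc k) = shift mv 1 (U k)"
    "\<And>k. k < len \<Longrightarrow> reads (S k) j \<noteq> Blank" "reads (S len) j = Blank"
  shows "runs (While j (Seq body (Act (moves mv)))) (S 0) (len * (b + 3) + 1) (S len)"
  using assms
proof (induction len arbitrary: S U)
  case 0
  then show ?case using runs_While_False by simp
next
  case (Suc len)
  have "runs (While j (Seq body (Act (moves mv)))) (S (Suc 0)) (len * (b + 3) + 1) (S (Suc len))"
  proof (rule Suc.IH[of "\<lambda>k. S (Suc k)" "\<lambda>k. U (Suc k)"])
    fix k assume "k < len"
    then have "Suc k < Suc len" by simp
    then show "runs body (S (Suc k)) b (U (Suc k))" "S (Suc (Suc k)) = shift mv 1 (U (Suc k))" "reads (S (Suc k)) j \<noteq> Blank"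
      using Suc.prems(1-3) by blast+
  qed (rule Suc.prems)
  moreover have "runs (Seq body (Act (moves mv))) (S 0) (b + 1 + 1) (S (Suc 0))"
    using runs_Seq[OF Suc.prems(1)[of 0] runs_Act[of "moves mv"]] Suc.prems(2)[of 0] by simp
  ultimately have "runs (While j (Seq body (Act (moves mv)))) (S 0) (b + 1 + 1 + (len * (b + 3) + 1) + 1) (S (Suc len))"
    using Suc.prems(3)[of 0] by (intro runs_While_True) auto
  then show ?case by (rule runs_mono) simp
qed

text \<open>\<open>S k\<close> is the store before round \<open>k\<close>, \<open>U k\<close> the
  one after its body but before the heads move on. A round costs \<open>b + 3\<close> steps, and
  rewinding two more per cell of the block.\<close>

lemma runs_For:
  assumes body: "\<And>k. k < len \<Longrightarrow> runs body (S k) b (U k)" "\<And>k. k < len \<Longrightarrow> S (Suc k) = shift mv 1 (U k)"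
    and mv: "mv j = MoveRight"
    and pos: "\<And>k. k \<le> len \<Longrightarrow> S k j = (r, int k)"
    and r: "\<And>i. 0 \<le> i \<Longrightarrow> i < int len \<Longrightarrow> r i \<noteq> Blank" "r (- 1) = Blank" "r (int len) = Blank"
    and final: "\<sigma>' = shift mv (- int len) (S len)"
  shows "runs (For j mv body) (S 0) (len * (b + 5) + 7) \<sigma>'"
proof -
  have "runs (While j (Seq body (Act (moves mv)))) (S 0) (len * (b + 3) + 1) (S len)"
    by (rule runs_While_forward[where U = U]) (use body pos r in \<open>auto simp: reads_def read_def\<close>)
  moreover have "runs (rewind j mv) (S len) (2 * len + 5) \<sigma>'"
    unfolding final by (rule runs_rewind[where p = "int len" and r = r]) (use mv pos r in auto)
  ultimately have "runs (For j mv body) (S 0) (len * (b + 3) + 1 + (2 * len + 5) + 1) \<sigma>'"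
    unfolding For_def by (rule runs_Seq)
  then show ?thesis by (rule runs_mono) (simp add: algebra_simps)
qed

section \<open>Output from nested loops\<close>

definition emit1 :: "bool \<Rightarrow> cmd" where
  "emit1 b = Act (\<lambda>n. if n = 10 then (Some (Bit b), MoveRight) else (None, Stay))"

definition emit :: "bool list \<Rightarrow> cmd" where
  "emit bs = seqs (map emit1 bs)"

text \<open>The form of tape 10 while output is appended; rewound, it becomes the input tape of the
  simulated machine.\<close>

definition outtape :: "bool list \<Rightarrow> tape" where
  "outtape s = (fst (input_tape s), int (length s))"

lemma outtape_append: "upd (Some (Bit b), MoveRight) (outtape s) = outtape (s @ [b])"
proof -
  have "(fst (input_tape s))(int (length s) := Bit b) = fst (input_tape (s @ [b]))"
    by (rule ext) (auto simp: input_tape_def nth_append nat_less_iff)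
  then show ?thesis by (simp add: outtape_def)
qed

text \<open>A number in unary, serving as the range of a \<open>For\<close> loop.\<close>

definition ruler :: "nat \<Rightarrow> int \<Rightarrow> symbol" where
  "ruler D i = (if 0 \<le> i \<and> i < int D then Aux 0 else Blank)"

lemma ruler_Suc: "(ruler D)(int D := Aux 0) = ruler (Suc D)"
  by (auto simp: ruler_def)

lemma ruler_0: "ruler 0 = (\<lambda>_. Blank)"
  by (auto simp: ruler_def)

text \<open>Only -1, 0 and 1 have to be told apart: they are the offsets of moves and the time
  differences that matter for \<open>conflict\<close>.\<close>

definition marks :: "int \<Rightarrow> symbol" where
  "marks i = (if i = - 1 then Aux 1 else if i = 0 then Aux 0 else if i = 1 then Aux 2 else Blank)"

text \<open>
  The tapes while the graph is written, for the pair of cells \<open>(t, i)\<close> and \<open>(t', i')\<close>: since tapes 5 to 9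
  carry marks around position 0 only, their heads tell the small values of \<open>t' - t\<close>, \<open>i' - i\<close>,
  \<open>t\<close>, \<open>t - T\<close> and \<open>i - T\<close>.  The head on the input tape is at the position represented by the cell.
\<close>
definition main_store :: "nat \<Rightarrow> bool list \<Rightarrow> store \<Rightarrow> bool list \<Rightarrow> int \<Rightarrow> int \<Rightarrow> int \<Rightarrow> int \<Rightarrow> store" where
  "main_store T x rest s t i t' i' = (\<lambda>n.
     if n = 0 then (fst (input_tape x), i - int T)
     else if n = 1 then (ruler (2*T), t)
     else if n = 2 then (ruler (2*T), i)
     else if n = 3 then (ruler (2*T), t')
     else if n = 4 then (ruler (2*T), i')
     else if n = 5 then (marks, t' - t)
     else if n = 6 then (marks, i' - i)
     else if n = 7 then (marks, t)
     else if n = 8 then (marks, t - int T)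
     else if n = 9 then (marks, i - int T)
     else if n = 10 then outtape s
     else rest n)"

text \<open>When \<open>t\<close> grows, the head holding \<open>t' - t\<close> has to go left.
  Moving heads jointly in this way keeps the differences up to date without subtraction.\<close>

definition mv_t :: "nat \<Rightarrow> move" where
  "mv_t n = (if n \<in> {1, 7, 8} then MoveRight else if n = 5 then MoveLeft else Stay)"
definition mv_i :: "nat \<Rightarrow> move" where
  "mv_i n = (if n \<in> {0, 2, 9} then MoveRight else if n = 6 then MoveLeft else Stay)"
definition mv_t' :: "nat \<Rightarrow> move" where
  "mv_t' n = (if n \<in> {3, 5} then MoveRight else Stay)"
definition mv_i' :: "nat \<Rightarrow> move" where
  "mv_i' n = (if n \<in> {4, 6} then MoveRight else Stay)"

lemma shift_main:
  "shift mv_t z (main_store T x rest s t i t' i') = main_store T x rest s (t + z) i t' i'"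
  "shift mv_i z (main_store T x rest s t i t' i') = main_store T x rest s t (i + z) t' i'"
  "shift mv_t' z (main_store T x rest s t i t' i') = main_store T x rest s t i (t' + z) i'"
  "shift mv_i' z (main_store T x rest s t i t' i') = main_store T x rest s t i t' (i' + z)"
  unfolding shift_def main_store_def mv_t_def mv_i_def mv_t'_def mv_i'_def by (rule ext; simp)+

lemma main_store_at:
  "main_store T x rest s t i t' i' (Suc 0) = (ruler (2 * T), t)"
  "main_store T x rest s t i t' i' 2 = (ruler (2 * T), i)"
  "main_store T x rest s t i t' i' 3 = (ruler (2 * T), t')"
  "main_store T x rest s t i t' i' 4 = (ruler (2 * T), i')"
  by (simp_all add: main_store_def)

text \<open>Independent of the output so far, and with all other heads back in place; therefore the
  output of nested loops is a nested concatenation.\<close>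

definition emits where
  "emits T x rest c t i t' i' b g \<longleftrightarrow>
     (\<forall>s. runs c (main_store T x rest s t i t' i') b (main_store T x rest (s @ g) t i t' i'))"

lemma emits_mono: "emits T x rest c t i t' i' b g \<Longrightarrow> b \<le> b' \<Longrightarrow> emits T x rest c t i t' i' b' g"
  unfolding emits_def using runs_mono by blast

lemma emits_Seq:
  "emits T x rest c t i t' i' b g \<Longrightarrow> emits T x rest d t i t' i' b' h \<Longrightarrow>
   emits T x rest (Seq c d) t i t' i' (b + b' + 1) (g @ h)"
  unfolding emits_def using runs_Seq by (metis append.assoc)

lemma emits_seqs:
  assumes "\<And>f. f \<in> set Fs \<Longrightarrow> emits T x rest (c f) t i t' i' b (g f)"
  shows "emits T x rest (seqs (map c Fs)) t i t' i' (length Fs * (b + 1) + 1) (concat (map g Fs))"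
  using assms
proof (induction Fs)
  case Nil
  then show ?case using runs_Skip by (simp add: emits_def)
next
  case (Cons f Fs)
  then have "emits T x rest (Seq (c f) (seqs (map c Fs))) t i t' i' (b + (length Fs * (b + 1) + 1) + 1) (g f @ concat (map g Fs))"
    by (intro emits_Seq) auto
  then show ?case by (simp add: emits_mono algebra_simps)
qed

lemma emits_emit1: "emits T x rest (emit1 y) t i t' i' 1 [y]"
proof -
  have "apply_effect (\<lambda>n. if n = 10 then (Some (Bit y), MoveRight) else (None, Stay)) (main_store T x rest s t i t' i')
      = main_store T x rest (s @ [y]) t i t' i'" for s
    by (rule ext) (auto simp: apply_effect_def main_store_def outtape_append simp del: upd_Some)
  then show ?thesis unfolding emits_def emit1_def using runs_Act by metis
qed

lemma emits_emit: "emits T x rest (emit bs) t i t' i' (length bs * 2 + 1) bs"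
  using emits_seqs[of bs T x rest emit1 t i t' i' 1 "\<lambda>b. [b]"] emits_emit1
  by (simp add: emit_def mult_2_right)

lemma emits_Case:
  assumes "\<And>s. reads (main_store T x rest s t i t' i') j = y" "emits T x rest (f y) t i t' i' b g"
  shows "emits T x rest (Case j f) t i t' i' (b + 1) g"
  using assms runs_Case unfolding emits_def by metis

text \<open>Common form of the four loops: one of the functions \<open>t\<close>, \<open>i\<close>,
  \<open>t'\<close>, \<open>i'\<close> will be the identity, the others constant.\<close>

lemma emits_For:
  assumes S: "\<And>s k. Sh s k = main_store T x rest s (t k) (i k) (t' k) (i' k)"
    and body: "\<And>k. k < 2 * T \<Longrightarrow> emits T x rest body (t (int k)) (i (int k)) (t' (int k)) (i' (int k)) b (g k)"
    and mv: "mv j = MoveRight" "\<And>s k z. shift mv z (Sh s k) = Sh s (k + z)"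
    and pos: "\<And>s k. Sh s k j = (ruler (2 * T), k)"
  shows "emits T x rest (For j mv body) (t 0) (i 0) (t' 0) (i' 0) (2 * T * (b + 5) + 7) (concat (map g [0..<2 * T]))"
proof -
  have "runs (For j mv body) (Sh s 0) (2 * T * (b + 5) + 7) (Sh (s @ concat (map g [0..<2 * T])) 0)" for s
  proof -
    let ?S = "\<lambda>k. Sh (s @ concat (map g [0..<k])) (int k)"
    let ?U = "\<lambda>k. Sh (s @ concat (map g [0..<Suc k])) (int k)"
    have "runs (For j mv body) (?S 0) (2 * T * (b + 5) + 7) (Sh (s @ concat (map g [0..<2 * T])) 0)"
    proof (rule runs_For[where S = ?S and U = ?U and r = "ruler (2 * T)"])
      show "runs body (?S k) b (?U k)" if "k < 2 * T" for k
        using body[OF that] unfolding emits_def S by (simp flip: append_assoc)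
    qed (use mv pos in \<open>auto simp: ruler_def add.commute\<close>)
    then show ?thesis by simp
  qed
  then show ?thesis unfolding emits_def S by simp
qed

lemma emits_For_t:
  assumes "\<And>k. k < 2 * T \<Longrightarrow> emits T x rest body (int k) i t' i' b (g k)"
  shows "emits T x rest (For 1 mv_t body) 0 i t' i' (2 * T * (b + 5) + 7) (concat (map g [0..<2 * T]))"
  by (rule emits_For[of "\<lambda>s k. main_store T x rest s k i t' i'" T x rest "\<lambda>k. k" "\<lambda>_. i" "\<lambda>_. t'" "\<lambda>_. i'"])
    (use assms in \<open>auto simp: shift_main mv_t_def main_store_at\<close>)

lemma emits_For_i:
  assumes "\<And>k. k < 2 * T \<Longrightarrow> emits T x rest body t (int k) t' i' b (g k)"
  shows "emits T x rest (For 2 mv_i body) t 0 t' i' (2 * T * (b + 5) + 7) (concat (map g [0..<2 * T]))"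
  by (rule emits_For[of "\<lambda>s k. main_store T x rest s t k t' i'" T x rest "\<lambda>_. t" "\<lambda>k. k" "\<lambda>_. t'" "\<lambda>_. i'"])
    (use assms in \<open>auto simp: shift_main mv_i_def main_store_at\<close>)

lemma emits_For_t':
  assumes "\<And>k. k < 2 * T \<Longrightarrow> emits T x rest body t i (int k) i' b (g k)"
  shows "emits T x rest (For 3 mv_t' body) t i 0 i' (2 * T * (b + 5) + 7) (concat (map g [0..<2 * T]))"
  by (rule emits_For[of "\<lambda>s k. main_store T x rest s t i k i'" T x rest "\<lambda>_. t" "\<lambda>_. i" "\<lambda>k. k" "\<lambda>_. i'"])
    (use assms in \<open>auto simp: shift_main mv_t'_def main_store_at\<close>)

lemma emits_For_i':
  assumes "\<And>k. k < 2 * T \<Longrightarrow> emits T x rest body t i t' (int k) b (g k)"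
  shows "emits T x rest (For 4 mv_i' body) t i t' 0 (2 * T * (b + 5) + 7) (concat (map g [0..<2 * T]))"
  by (rule emits_For[of "\<lambda>s k. main_store T x rest s t i t' k" T x rest "\<lambda>_. t" "\<lambda>_. i" "\<lambda>_. t'" "\<lambda>k. k"])
    (use assms in \<open>auto simp: shift_main mv_i'_def main_store_at\<close>)

definition over_cells :: "cmd \<Rightarrow> cmd" where
  "over_cells body = For 1 mv_t (For 2 mv_i body)"

definition over_cells' :: "cmd \<Rightarrow> cmd" where
  "over_cells' body = For 3 mv_t' (For 4 mv_i' body)"

definition cells_time :: "nat \<Rightarrow> nat \<Rightarrow> nat" where
  "cells_time T b = 2 * T * ((2 * T * (b + 5) + 7) + 5) + 7"

lemma emits_over_cells:
  assumes "\<And>t i. t < 2 * T \<Longrightarrow> i < 2 * T \<Longrightarrow> emits T x rest body (int t) (int i) t' i' b (g t i)"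
  shows "emits T x rest (over_cells body) 0 0 t' i' (cells_time T b)
    (concat (map (\<lambda>t. concat (map (g t) [0..<2 * T])) [0..<2 * T]))"
  unfolding over_cells_def cells_time_def by (intro emits_For_t emits_For_i assms)

lemma emits_over_cells':
  assumes "\<And>t' i'. t' < 2 * T \<Longrightarrow> i' < 2 * T \<Longrightarrow> emits T x rest body t i (int t') (int i') b (g t' i')"
  shows "emits T x rest (over_cells' body) t i 0 0 (cells_time T b)
    (concat (map (\<lambda>t. concat (map (g t) [0..<2 * T])) [0..<2 * T]))"
  unfolding over_cells'_def cells_time_def by (intro emits_For_t' emits_For_i' assms)

text \<open>Recovers -1, 0 and 1 from their marks; all other numbers have a blank mark and are
  represented by 2.\<close>

fun mark_value :: "symbol \<Rightarrow> int" where
  "mark_value (Aux n) = (if n = 0 then 0 else if n = 1 then - 1 else 1)"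
| "mark_value s = 2"

text \<open>\<open>conflict\<close> compares the differences only with 0, 1 and offsets of moves, so
  2 and -2 act like any other large difference.\<close>

lemma conflict_marks:
  "conflict k (mark_value (marks dt)) (mark_value (marks di)) a b = conflict k dt di a b"
  "conflict k (- mark_value (marks dt)) (- mark_value (marks di)) a b = conflict k (- dt) (- di) a b"
proof -
  have "follows k (mark_value (marks di)) a b = follows k di a b"
    "follows k (- mark_value (marks di)) a b = follows k (- di) a b"
    for k
  proof -
    have "mark_value (marks di) = offset m \<longleftrightarrow> di = offset m" "- mark_value (marks di) = offset m \<longleftrightarrow> - di = offset m" for m
      by (cases m; auto simp: marks_def)+
    moreover have "mark_value (marks di) = 0 \<longleftrightarrow> di = 0" by (auto simp: marks_def)
    ultimately show "follows k (mark_value (marks di)) a b = follows k di a b"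
      "follows k (- mark_value (marks di)) a b = follows k (- di) a b"
      by (cases a; cases b; simp add: follows_def)+
  qed
  moreover have "mark_value (marks d) = 0 \<longleftrightarrow> d = 0" "mark_value (marks d) = 1 \<longleftrightarrow> d = 1" "mark_value (marks d) = - 1 \<longleftrightarrow> d = - 1" for d
    by (auto simp: marks_def)
  ultimately show "conflict k (mark_value (marks dt)) (mark_value (marks di)) a b = conflict k dt di a b"
    "conflict k (- mark_value (marks dt)) (- mark_value (marks di)) a b = conflict k (- dt) (- di) a b"
    by (auto simp: conflict_def minus_equation_iff[of _ 1])
qed

lemma adjacent_marks:
  "adjacent k (mark_value (marks dt)) (mark_value (marks di)) a b = adjacent k dt di a b"
  by (cases a; cases b) (auto simp: conflict_marks)

section \<open>The three blocks of the code of the graph\<close>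

definition write_order :: "cell option list \<Rightarrow> cmd" where
  "write_order F = Seq (over_cells (emit (replicate (length F) True))) (emit [False])"

text \<open>Once the four symbols are known, the code of the weight is a constant. On tape 8, whose
  head is at \<open>t - T\<close>, the mark \<open>Aux 1\<close> at -1 signals
  \<open>Suc t = T\<close>.\<close>

definition write_weights :: "machine \<Rightarrow> cell option list \<Rightarrow> cmd" where
  "write_weights M F = over_cells (seqs (map (\<lambda>f.
     Case 0 (\<lambda>b. Case 9 (\<lambda>z. Case 7 (\<lambda>t0. Case 8 (\<lambda>t1.
       emit (encode_nat (cell_weight M b (z = Aux 0) (t0 = Aux 0) (t1 = Aux 1) f))))))) F))"

definition write_matrix :: "nat \<Rightarrow> cell option list \<Rightarrow> cmd" where
  "write_matrix k F = over_cells (seqs (map (\<lambda>f. over_cells' (seqs (map (\<lambda>f'.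
     Case 5 (\<lambda>dt. Case 6 (\<lambda>di. emit [adjacent k (mark_value dt) (mark_value di) f f']))) F))) F))"

definition write_graph :: "machine \<Rightarrow> cell option list \<Rightarrow> cmd" where
  "write_graph M F = Seq (write_order F) (Seq (write_weights M F) (write_matrix (tapes M) F))"

lemma concat_upt_mult:
  fixes a b :: nat
  shows "concat (map g [0..<a * b]) = concat (map (\<lambda>i. concat (map (\<lambda>j. g (i * b + j)) [0..<b])) [0..<a])"
proof (induction a)
  case (Suc a)
  have "[0..<Suc a * b] = [0..<a * b] @ map (\<lambda>j. a * b + j) [0..<b]"
    using upt_add_eq_append[of 0 "a * b" b] map_upt_shift[of "\<lambda>i. i" "a * b" b] by (simp add: add.commute)
  then show ?case using Suc by (simp add: comp_def)
qed simp

text \<open>Counting through the vertex numbers is the lexicographic order of their digits, which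
  turns the lists in \<open>encode_graph\<close> into the nested loops of the program.\<close>

lemma concat_vertices:
  assumes "\<And>t i j. t < D \<Longrightarrow> i < D \<Longrightarrow> j < length F \<Longrightarrow> g ((t * D + i) * length F + j) = h t i (F ! j)"
  shows "concat (map g [0..<D * D * length F]) =
    concat (map (\<lambda>t. concat (map (\<lambda>i. concat (map (h t i) F)) [0..<D])) [0..<D])"
proof -
  have "map (h t i) F = map (\<lambda>j. h t i (F ! j)) [0..<length F]" for t i
    by (rule nth_equalityI) auto
  then show ?thesis
    unfolding concat_upt_mult using assms by (auto intro!: arg_cong[of _ _ concat] map_cong)
qed

lemma reads_main:
  "reads (main_store T x rest s t i t' i') 0 = fst (input_tape x) (i - int T)"
  "reads (main_store T x rest s t i t' i') 5 = marks (t' - t)"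
  "reads (main_store T x rest s t i t' i') 6 = marks (i' - i)"
  "reads (main_store T x rest s t i t' i') 7 = marks t"
  "reads (main_store T x rest s t i t' i') 8 = marks (t - int T)"
  "reads (main_store T x rest s t i t' i') 9 = marks (i - int T)"
  by (simp_all add: reads_def read_def main_store_def)

lemma length_encode_nat_le: "n \<le> 1 \<Longrightarrow> length (encode_nat n) \<le> 3"
  by (cases n) (auto simp: encode_nat_def binary.simps)

lemma vertex_coords:
  assumes "i < D" "j < m"
  shows "time_of D m ((t * D + i) * m + j) = t" "pos_of D m ((t * D + i) * m + j) = i" "((t * D + i) * m + j) mod m = j"
  using assms by (auto simp: time_of_def pos_of_def)

lemma emits_order:
  "emits T x rest (write_order F) 0 0 0 0 (cells_time T (length F * 2 + 1) + 3 + 1)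
    (replicate (2 * T * (2 * T) * length F) True @ [False])"
proof -
  have "emits T x rest (over_cells (emit (replicate (length F) True))) 0 0 0 0 (cells_time T (length F * 2 + 1))
    (concat (map (\<lambda>t. concat (map (\<lambda>i. replicate (length F) True) [0..<2 * T])) [0..<2 * T]))"
    by (rule emits_over_cells) (use emits_emit[of T x rest "replicate (length F) True"] in simp)
  moreover have "concat (map (\<lambda>t. concat (map (\<lambda>i. replicate (length F) True) [0..<2 * T])) [0..<2 * T]) =
      replicate (2 * T * (2 * T) * length F) True"
  proof -
    have "concat (map (\<lambda>i. replicate a True) [0..<n]) = replicate (n * a) True" for a n
      by (induction n) (auto simp flip: replicate_add simp: add.commute)
    then show ?thesis by (simp add: mult.assoc)
  qed
  ultimately show ?thesis
    unfolding write_order_def using emits_Seq[OF _ emits_emit[of T x rest "[False]"]] by fastforce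
qed

text \<open>A weight is 0 or 1, so its code has at most three bits, emitted in 7 steps; four
  \<open>Case\<close> commands and the \<open>Seq\<close> joining it to the next entry make
  12.\<close>

lemma emits_weights:
  "emits T x rest (write_weights M F) 0 0 0 0 (cells_time T (length F * 12 + 1))
    (concat (map (\<lambda>v. encode_nat (tableau_weight M F x T v)) [0..<2 * T * (2 * T) * length F]))"
proof -
  define h where "h t i f = encode_nat (cell_weight M (fst (input_tape x) (int i - int T)) (i = T) (t = 0) (Suc t = T) f)"
    for t i f
  have cw: "cell_weight M b z u v f \<le> 1" for b z u v f by (cases f) auto
  have "emits T x rest (Case 0 (\<lambda>b. Case 9 (\<lambda>z. Case 7 (\<lambda>t0. Case 8 (\<lambda>t1.
       emit (encode_nat (cell_weight M b (z = Aux 0) (t0 = Aux 0) (t1 = Aux 1) f)))))))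
       (int t) (int i) 0 0 (7 + 1 + 1 + 1 + 1) (h t i f)" for t i f
  proof (intro emits_Case)
    have "marks (int i - int T) = Aux 0 \<longleftrightarrow> i = T" "marks (int t) = Aux 0 \<longleftrightarrow> t = 0"
      "marks (int t - int T) = Aux 1 \<longleftrightarrow> Suc t = T"
      by (auto simp: marks_def)
    note flags = this
    have "length (h t i f) \<le> 3"
      unfolding h_def by (rule length_encode_nat_le[OF cw])
    then have len: "length (h t i f) * 2 + 1 \<le> 7" by simp
    show "emits T x rest (emit (encode_nat (cell_weight M (fst (input_tape x) (int i - int T))
        (marks (int i - int T) = Aux 0) (marks (int t) = Aux 0) (marks (int t - int T) = Aux 1) f)))
        (int t) (int i) 0 0 7 (h t i f)"
      unfolding flags h_def[symmetric] using len by (rule emits_mono[OF emits_emit])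
  qed (rule reads_main)+
  then have "emits T x rest (write_weights M F) 0 0 0 0 (cells_time T (length F * (11 + 1) + 1))
    (concat (map (\<lambda>t. concat (map (\<lambda>i. concat (map (h t i) F)) [0..<2 * T])) [0..<2 * T]))"
    unfolding write_weights_def by (intro emits_over_cells emits_seqs) simp
  moreover have "concat (map (\<lambda>v. encode_nat (tableau_weight M F x T v)) [0..<2 * T * (2 * T) * length F]) =
    (concat (map (\<lambda>t. concat (map (\<lambda>i. concat (map (h t i) F)) [0..<2 * T])) [0..<2 * T]))"
    by (rule concat_vertices) (simp add: tableau_weight_def vertex_coords h_def Let_def)
  ultimately show ?thesis by simp
qed

text \<open>Rows and columns of the matrix are both indexed by vertices, so
  \<open>concat_vertices\<close> is applied twice, once inside the other.\<close>

lemma emits_matrix: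
  "emits T x rest (write_matrix k F) 0 0 0 0
    (cells_time T (length F * (cells_time T (length F * 6 + 1) + 1) + 1))
    (map (\<lambda>(u, v). {u, v} \<in> tableau_edges k F (2 * T))
      (List.product [0..<2 * T * (2 * T) * length F] [0..<2 * T * (2 * T) * length F]))"
proof -
  let ?D = "2 * T" and ?N = "2 * T * (2 * T) * length F"
  define h where "h t i f t' i' f' = [adjacent k (int t' - int t) (int i' - int i) f f']" for t i t' i' f f'
  have "emits T x rest (Case 5 (\<lambda>dt. Case 6 (\<lambda>di. emit [adjacent k (mark_value dt) (mark_value di) f f'])))
       (int t) (int i) (int t') (int i') (3 + 1 + 1) (h t i f t' i' f')" for t i t' i' f f'
  proof (intro emits_Case)
    show "emits T x rest (emit [adjacent k (mark_value (marks (int t' - int t))) (mark_value (marks (int i' - int i))) f f'])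
       (int t) (int i) (int t') (int i') 3 (h t i f t' i' f')"
      unfolding h_def adjacent_marks using emits_emit[of T x rest "[_]"] by simp
  qed (rule reads_main)+
  then have "emits T x rest (write_matrix k F) 0 0 0 0
    (cells_time T (length F * (cells_time T (length F * (5 + 1) + 1) + 1) + 1))
    (concat (map (\<lambda>t. concat (map (\<lambda>i. concat (map (\<lambda>f.
       concat (map (\<lambda>t'. concat (map (\<lambda>i'. concat (map (h t i f t' i') F)) [0..<?D])) [0..<?D])) F)) [0..<?D])) [0..<?D]))"
    unfolding write_matrix_def by (intro emits_over_cells emits_over_cells' emits_seqs) simp
  moreover have "map (\<lambda>(u, v). {u, v} \<in> tableau_edges k F ?D) (List.product [0..<?N] [0..<?N]) =
     concat (map (\<lambda>u. concat (map (\<lambda>v. [{u, v} \<in> tableau_edges k F ?D]) [0..<?N])) [0..<?N])"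
    by (simp add: product_concat_map map_concat comp_def)
  moreover have "\<dots> = concat (map (\<lambda>t. concat (map (\<lambda>i. concat (map (\<lambda>f.
       concat (map (\<lambda>t'. concat (map (\<lambda>i'. concat (map (h t i f t' i') F)) [0..<?D])) [0..<?D])) F)) [0..<?D])) [0..<?D])"
  proof (rule concat_vertices)
    fix t i j assume ti: "t < ?D" "i < ?D" "j < length F"
    let ?u = "(t * ?D + i) * length F + j"
    show "concat (map (\<lambda>v. [{?u, v} \<in> tableau_edges k F ?D]) [0..<?N]) =
      concat (map (\<lambda>t'. concat (map (\<lambda>i'. concat (map (h t i (F ! j) t' i') F)) [0..<?D])) [0..<?D])"
    proof (rule concat_vertices)
      fix t' i' j' assume ti': "t' < ?D" "i' < ?D" "j' < length F"
      show "[{?u, (t' * ?D + i') * length F + j'} \<in> tableau_edges k F ?D] = h t i (F ! j) t' i' (F ! j')"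
        using tableau_edges_iff[OF vertex_bounds[OF ti] vertex_bounds[OF ti'], of k] ti ti'
        by (simp add: tableau_adjacent_def vertex_coords h_def)
    qed
  qed
  ultimately show ?thesis by simp
qed

definition write_time :: "nat \<Rightarrow> nat \<Rightarrow> nat" where
  "write_time m T = cells_time T (m * 2 + 1) + 3 + 1 +
     (cells_time T (m * 12 + 1) + cells_time T (m * (cells_time T (m * 6 + 1) + 1) + 1) + 1) + 1"

lemma emits_write_graph:
  "emits T x rest (write_graph M F) 0 0 0 0 (write_time (length F) T)
    (encode_graph (2 * T * (2 * T) * length F) (tableau_edges (tapes M) F (2 * T)) (tableau_weight M F x T))"
  unfolding write_graph_def write_time_def encode_graph_def
  using emits_Seq[OF emits_order emits_Seq[OF emits_weights emits_matrix]] by simp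

section \<open>The reduction\<close>

definition on :: "nat set \<Rightarrow> symbol option \<times> move \<Rightarrow> effect" where
  "on J a = (\<lambda>n. if n \<in> J then a else (None, Stay))"

definition right_on :: "nat set \<Rightarrow> nat \<Rightarrow> move" where
  "right_on J = (\<lambda>n. if n \<in> J then MoveRight else Stay)"

definition write_marks :: cmd where
  "write_marks = seqs (map (\<lambda>a. Act (on {5..9} a))
     [(Some (Aux 0), MoveLeft), (Some (Aux 1), MoveRight), (None, MoveRight), (Some (Aux 2), MoveLeft)])"

text \<open>
  The tapes while the rulers are extended to length \<open>2 * T\<close>; the loops doing this count on the tapes in \<open>J\<close>.
\<close>
definition setup_store :: "nat set \<Rightarrow> bool list \<Rightarrow> int \<Rightarrow> nat \<Rightarrow> int \<Rightarrow> int \<Rightarrow> nat \<Rightarrow> (nat \<Rightarrow> int) \<Rightarrow> store" where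
  "setup_store J x hx r hr hm B hX = (\<lambda>n.
     if n = 0 then (fst (input_tape x), hx)
     else if n \<le> 4 then (ruler r, hr)
     else if n \<le> 7 then (marks, 0)
     else if n \<le> 9 then (marks, hm)
     else if n \<in> J then (ruler B, hX n)
     else blank_tape)"

lemma runs_write_marks:
  "runs write_marks (init_store x) 9 (setup_store J x 0 0 0 0 0 (\<lambda>_. 0))"
proof -
  have "apply_effect (on {5..9} (Some (Aux 2), MoveLeft)) (apply_effect (on {5..9} (None, MoveRight))
     (apply_effect (on {5..9} (Some (Aux 1), MoveRight)) (apply_effect (on {5..9} (Some (Aux 0), MoveLeft)) (init_store x)))) =
     setup_store J x 0 0 0 0 0 (\<lambda>_. 0)"
    by (rule ext) (auto simp: apply_effect_def on_def init_store_def setup_store_def blank_tape_def ruler_0 marks_def input_tape_def)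
  from this[symmetric] show ?thesis unfolding write_marks_def list.map seqs.simps
    by (auto intro!: runs_weaken[OF runs_Seq[OF runs_Act runs_Seq[OF runs_Act runs_Seq[OF runs_Act runs_Seq[OF runs_Act runs_Skip]]]]])
qed

section \<open>Computing \<open>T\<close> by nested loops\<close>

definition extend :: "nat set \<Rightarrow> cmd" where
  "extend J = Act (on J (Some (Aux 0), MoveRight))"

text \<open>One pass over the input makes all counters as long as the input, and \<open>b\<close>
  further steps give them the length \<open>n + b\<close>, the base of the power
  \<open>T\<close>.\<close>

definition make_counters :: "nat set \<Rightarrow> nat \<Rightarrow> nat \<Rightarrow> cmd" where
  "make_counters J j b = Seq (For 0 (right_on {0}) (extend J))
     (Seq (seqs (replicate b (extend J))) (rewind j (right_on J)))"

lemma runs_extend: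
  assumes "J \<inter> {..10} = {}"
  shows "runs (extend J) (setup_store J x hx r hr hm k (\<lambda>_. int k)) 1 (setup_store J x hx r hr hm (Suc k) (\<lambda>_. int (Suc k)))"
proof -
  have "apply_effect (on J (Some (Aux 0), MoveRight)) (setup_store J x hx r hr hm k (\<lambda>_. int k)) =
      setup_store J x hx r hr hm (Suc k) (\<lambda>_. int (Suc k))"
    using assms by (intro ext) (auto simp: apply_effect_def on_def setup_store_def ruler_Suc disjoint_iff)
  then show ?thesis unfolding extend_def using runs_Act by metis
qed

lemma runs_extends:
  assumes "J \<inter> {..10} = {}"
  shows "runs (seqs (replicate b (extend J))) (setup_store J x hx r hr hm k (\<lambda>_. int k)) (2 * b + 1)
     (setup_store J x hx r hr hm (k + b) (\<lambda>_. int (k + b)))"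
proof (induction b arbitrary: k)
  case 0
  then show ?case using runs_Skip by simp
next
  case (Suc b)
  from runs_Seq[OF runs_extend[OF assms] Suc] show ?case
    unfolding replicate.simps seqs.simps by (rule runs_weaken) simp_all
qed

lemma shift_right_on: "shift (right_on J) z \<sigma> = (\<lambda>n. if n \<in> J then (fst (\<sigma> n), snd (\<sigma> n) + z) else \<sigma> n)"
  by (auto simp: shift_def right_on_def)

lemma runs_make_counters:
  assumes J: "J \<inter> {..10} = {}" "j \<in> J"
  shows "runs (make_counters J j b) (setup_store J x 0 r hr hm 0 (\<lambda>_. 0)) (8 * length x + 4 * b + 15)
     (setup_store J x 0 r hr hm (length x + b) (\<lambda>_. 0))"
proof -
  let ?n = "length x"
  let ?S = "\<lambda>k. setup_store J x (int k) r hr hm k (\<lambda>_. int k)"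
  let ?U = "\<lambda>k. setup_store J x (int k) r hr hm (Suc k) (\<lambda>_. int (Suc k))"
  have "runs (For 0 (right_on {0}) (extend J)) (?S 0) (?n * (1 + 5) + 7) (setup_store J x 0 r hr hm ?n (\<lambda>_. int ?n))"
  proof (rule runs_For[where S = ?S and U = ?U and r = "fst (input_tape x)"])
    show "runs (extend J) (?S k) 1 (?U k)" for k by (rule runs_extend[OF J(1)])
    show "?S (Suc k) = shift (right_on {0}) 1 (?U k)" for k
      unfolding shift_right_on by (rule ext) (auto simp: setup_store_def)
    show "setup_store J x 0 r hr hm ?n (\<lambda>_. int ?n) = shift (right_on {0}) (- int ?n) (?S ?n)"
      unfolding shift_right_on by (rule ext) (auto simp: setup_store_def)
  qed (auto simp: right_on_def setup_store_def input_tape_def)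
  moreover have "runs (rewind j (right_on J)) (setup_store J x 0 r hr hm (?n + b) (\<lambda>_. int (?n + b))) (2 * (?n + b) + 5)
     (shift (right_on J) (- int (?n + b)) (setup_store J x 0 r hr hm (?n + b) (\<lambda>_. int (?n + b))))"
    by (rule runs_rewind[where p = "int (?n + b)" and r = "ruler (?n + b)"])
      (use J in \<open>auto simp: right_on_def ruler_def setup_store_def disjoint_iff\<close>)
  moreover have "shift (right_on J) (- int (?n + b)) (setup_store J x 0 r hr hm (?n + b) (\<lambda>_. int (?n + b))) =
     setup_store J x 0 r hr hm (?n + b) (\<lambda>_. 0)"
    unfolding shift_right_on using J by (intro ext) (auto simp: setup_store_def disjoint_iff)
  ultimately have "runs (make_counters J j b) (?S 0) (?n * (1 + 5) + 7 + ((2 * b + 1) + (2 * (?n + b) + 5) + 1) + 1)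
     (setup_store J x 0 r hr hm (?n + b) (\<lambda>_. 0))"
    unfolding make_counters_def by (intro runs_Seq[OF _ runs_Seq[OF runs_extends[OF J(1)]]]) simp_all
  then show ?thesis unfolding of_nat_0 by (rule runs_weaken) simp_all
qed

text \<open>Raises \<open>T\<close> by 1: the rulers become longer by 2, and the heads on tapes 0, 8
  and 9 go one position to the left, so that they arrive at \<open>- T\<close>, where the cell
  \<open>(0, 0)\<close> wants them.\<close>

definition grow :: cmd where
  "grow = Seq (Act (\<lambda>n. if n \<in> {0, 8, 9} then (None, MoveLeft) else on {1..4} (Some (Aux 0), MoveRight) n))
     (Act (on {1..4} (Some (Aux 0), MoveRight)))"

definition growth_store :: "nat set \<Rightarrow> bool list \<Rightarrow> nat \<Rightarrow> nat \<Rightarrow> (nat \<Rightarrow> int) \<Rightarrow> store" where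
  "growth_store J x B T hX = setup_store J x (- int T) (2 * T) (int (2 * T)) (- int T) B hX"

lemma runs_grow:
  assumes "J \<inter> {..10} = {}"
  shows "runs grow (growth_store J x B T hX) 3 (growth_store J x B (Suc T) hX)"
proof -
  have ruler2: "(ruler (2 * T))(int (2 * T) := Aux 0, 1 + int (2 * T) := Aux 0) = ruler (2 * Suc T)"
    by (auto simp: ruler_def)
  have "apply_effect (on {1..4} (Some (Aux 0), MoveRight))
     (apply_effect (\<lambda>n. if n \<in> {0, 8, 9} then (None, MoveLeft) else on {1..4} (Some (Aux 0), MoveRight) n)
       (growth_store J x B T hX)) = growth_store J x B (Suc T) hX"
    using assms ruler2
    by (intro ext) (auto simp: apply_effect_def on_def growth_store_def setup_store_def disjoint_iff add.commute)
  from runs_weaken[OF runs_Seq[OF runs_Act runs_Act] _ this] show ?thesis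
    unfolding grow_def by simp
qed

text \<open>A power is obtained by mere nesting: with every counter of length \<open>B\<close>,
  \<open>grow\<close> is executed \<open>B ^ length js\<close> times. Each loop needs a tape of its
  own, as its variable is a head position.\<close>

primrec nest :: "nat list \<Rightarrow> cmd" where
  "nest [] = grow"
| "nest (j # js) = For j (right_on {j}) (nest js)"

primrec nest_time :: "nat \<Rightarrow> nat \<Rightarrow> nat" where
  "nest_time B 0 = 3"
| "nest_time B (Suc d) = B * (nest_time B d + 5) + 7"

text \<open>\<open>hX\<close> is arbitrary in the induction because the inner loops run while the
  heads of the enclosing loops are somewhere in their blocks.\<close>

lemma runs_nest:
  assumes J: "J \<inter> {..10} = {}"
  shows "set js \<subseteq> J \<Longrightarrow> distinct js \<Longrightarrow> (\<And>j. j \<in> set js \<Longrightarrow> hX j = 0) \<Longrightarrow>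
    runs (nest js) (growth_store J x B T hX) (nest_time B (length js)) (growth_store J x B (T + B ^ length js) hX)"
proof (induction js arbitrary: T hX)
  case Nil
  then show ?case using runs_grow[OF J] by simp
next
  case (Cons j js)
  let ?S = "\<lambda>k. growth_store J x B (T + k * B ^ length js) (hX(j := int k))"
  let ?U = "\<lambda>k. growth_store J x B (T + k * B ^ length js + B ^ length js) (hX(j := int k))"
  have "runs (For j (right_on {j}) (nest js)) (?S 0) (B * (nest_time B (length js) + 5) + 7)
    (growth_store J x B (T + B ^ length (j # js)) hX)"
  proof (rule runs_For[where S = ?S and U = ?U and r = "ruler B"])
    show "runs (nest js) (?S k) (nest_time B (length js)) (?U k)" for k
      by (rule Cons.IH) (use Cons.prems in auto)
    show "?S (Suc k) = shift (right_on {j}) 1 (?U k)" for k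
      unfolding shift_right_on using Cons.prems J
      by (intro ext) (auto simp: growth_store_def setup_store_def disjoint_iff algebra_simps)
    show "growth_store J x B (T + B ^ length (j # js)) hX = shift (right_on {j}) (- int B) (?S B)"
      unfolding shift_right_on using Cons.prems J
      by (intro ext) (auto simp: growth_store_def setup_store_def disjoint_iff)
    show "?S k j = (ruler B, int k)" for k
      using Cons.prems J by (auto simp: growth_store_def setup_store_def disjoint_iff)
  qed (auto simp: right_on_def ruler_def)
  moreover have "hX(j := 0) = hX" using Cons.prems by auto
  ultimately show ?case by simp
qed

text \<open>What the computation of \<open>T\<close> leaves behind. These tapes are placed after
  those of \<open>A\<close>, so that \<open>A\<close> finds its own work tapes blank.\<close>

definition counters :: "nat set \<Rightarrow> nat \<Rightarrow> store" where
  "counters J B = (\<lambda>n. if n \<in> J then (ruler B, 0) else blank_tape)"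

lemma runs_rewind_rulers:
  "runs (rewind 1 (right_on {1..4})) (growth_store J x B T (\<lambda>_. 0)) (4 * T + 5) (main_store T x (counters J B) [] 0 0 0 0)"
  if J: "J \<inter> {..10} = {}"
proof -
  have "runs (rewind 1 (right_on {1..4})) (growth_store J x B T (\<lambda>_. 0)) (2 * (2 * T) + 5)
      (shift (right_on {1..4}) (- int (2 * T)) (growth_store J x B T (\<lambda>_. 0)))"
    by (rule runs_rewind[where p = "int (2 * T)" and r = "ruler (2 * T)"])
      (auto simp: right_on_def ruler_def growth_store_def setup_store_def)
  moreover have "shift (right_on {1..4}) (- int (2 * T)) (growth_store J x B T (\<lambda>_. 0)) = main_store T x (counters J B) [] 0 0 0 0"
  proof (rule ext)
    fix n :: nat
    have "n \<in> {0, 1, 2, 3, 4, 5, 6, 7, 8, 9, 10} \<or> n > 10"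
      by (cases "n > 10") (auto simp: not_less le_Suc_eq numeral_eq_Suc)
    then show "shift (right_on {1..4}) (- int (2 * T)) (growth_store J x B T (\<lambda>_. 0)) n = main_store T x (counters J B) [] 0 0 0 0 n"
      unfolding shift_right_on using J
      by (elim disjE) (auto simp: growth_store_def setup_store_def main_store_def counters_def outtape_def input_tape_def blank_tape_def disjoint_iff)
  qed
  ultimately show ?thesis by simp
qed

lemma runs_rewind_output:
  "\<exists>\<sigma>. runs (rewind 10 (right_on {10})) (main_store T x (counters J B) y 0 0 0 0) (2 * length y + 5) \<sigma> \<and>
    \<sigma> 10 = input_tape y \<and> (\<forall>n>10. n \<notin> J \<longrightarrow> \<sigma> n = blank_tape)"
proof (intro exI conjI)
  show "runs (rewind 10 (right_on {10})) (main_store T x (counters J B) y 0 0 0 0) (2 * length y + 5)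
     (shift (right_on {10}) (- int (length y)) (main_store T x (counters J B) y 0 0 0 0))"
    by (rule runs_rewind[where p = "int (length y)" and r = "fst (input_tape y)"])
      (auto simp: right_on_def main_store_def outtape_def input_tape_def)
qed (auto simp: shift_right_on main_store_def outtape_def counters_def input_tape_def)

definition reduction_cmd :: "nat \<Rightarrow> nat \<Rightarrow> nat \<Rightarrow> machine \<Rightarrow> cell option list \<Rightarrow> cmd" where
  "reduction_cmd p b c M F =
     Seq write_marks (Seq (make_counters {p..<p + c} p b) (Seq (nest [p..<p + c]) (Seq (rewind 1 (right_on {1..4}))
       (Seq (write_graph M F) (rewind 10 (right_on {10}))))))"

definition reduction_time :: "nat \<Rightarrow> nat \<Rightarrow> nat \<Rightarrow> nat \<Rightarrow> nat \<Rightarrow> nat" where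
  "reduction_time b c m n ly = 9 + ((8 * n + 4 * b + 15) + (nest_time (n + b) c + ((4 * (n + b) ^ c + 5) +
     (write_time m ((n + b) ^ c) + (2 * ly + 5) + 1) + 1) + 1) + 1) + 1"

lemma runs_reduction:
  assumes p: "p > 10" and c: "c \<ge> 1" and T: "T = (length x + b) ^ c"
    and y: "y = encode_graph (2 * T * (2 * T) * length F) (tableau_edges (tapes M) F (2 * T)) (tableau_weight M F x T)"
  shows "\<exists>\<sigma>. runs (reduction_cmd p b c M F) (init_store x) (reduction_time b c (length F) (length x) (length y)) \<sigma> \<and>
    \<sigma> 10 = input_tape y \<and> (\<forall>n>10. n < p \<longrightarrow> \<sigma> n = blank_tape)"
proof -
  let ?J = "{p..<p + c}" and ?B = "length x + b"
  have J: "?J \<inter> {..10} = {}" "p \<in> ?J" using p c by auto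
  obtain \<sigma> where \<sigma>: "runs (rewind 10 (right_on {10})) (main_store T x (counters ?J ?B) y 0 0 0 0) (2 * length y + 5) \<sigma>"
    "\<sigma> 10 = input_tape y" "\<forall>n>10. n \<notin> ?J \<longrightarrow> \<sigma> n = blank_tape"
    using runs_rewind_output by blast
  have 1: "runs (make_counters ?J p b) (setup_store ?J x 0 0 0 0 0 (\<lambda>_. 0)) (8 * length x + 4 * b + 15)
      (growth_store ?J x ?B 0 (\<lambda>_. 0))"
    using runs_make_counters[OF J, of b x 0 0 0] by (simp add: growth_store_def)
  have 2: "runs (nest [p..<p + c]) (growth_store ?J x ?B 0 (\<lambda>_. 0)) (nest_time ?B c) (growth_store ?J x ?B T (\<lambda>_. 0))"
    using runs_nest[OF J(1), of "[p..<p + c]" "\<lambda>_. 0" x ?B 0] by (simp add: T)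
  have 3: "runs (write_graph M F) (main_store T x (counters ?J ?B) [] 0 0 0 0) (write_time (length F) T)
      (main_store T x (counters ?J ?B) y 0 0 0 0)"
    using emits_write_graph[of T x "counters ?J ?B" M F] unfolding emits_def y by (metis append_Nil)
  show ?thesis
    using runs_Seq[OF runs_write_marks runs_Seq[OF 1 runs_Seq[OF 2 runs_Seq[OF runs_rewind_rulers[OF J(1)] runs_Seq[OF 3 \<sigma>(1)]]]]] \<sigma>(2,3)
    unfolding reduction_cmd_def reduction_time_def T[symmetric] by (intro exI[of _ \<sigma>]) simp
qed

lemma wf_seqs: "wf_cmd k \<Sigma> (seqs cs) \<longleftrightarrow> (\<forall>c\<in>set cs. wf_cmd k \<Sigma> c)"
  by (induction cs) auto

lemma wf_rewind: "wf_cmd k \<Sigma> (rewind j mv) \<longleftrightarrow> j < k"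
  by (auto simp: rewind_def moves_def moves_back_def)

lemma wf_For: "wf_cmd k \<Sigma> (For j mv c) \<longleftrightarrow> j < k \<and> wf_cmd k \<Sigma> c"
  by (auto simp: For_def wf_rewind moves_def)

lemma wf_emit: "range Bit \<subseteq> \<Sigma> \<Longrightarrow> wf_cmd k \<Sigma> (emit bs)"
  by (auto simp: emit_def emit1_def wf_seqs)

lemma wf_nest: "set js \<subseteq> {..<k} \<Longrightarrow> Aux 0 \<in> \<Sigma> \<Longrightarrow> wf_cmd k \<Sigma> (nest js)"
  by (induction js) (auto simp: wf_For grow_def on_def)

lemma wf_reduction_cmd:
  assumes "p > 10" "c \<ge> 1" "range Bit \<subseteq> \<Sigma>" "{Aux 0, Aux 1, Aux 2} \<subseteq> \<Sigma>"
  shows "wf_cmd (p + c) \<Sigma> (reduction_cmd p b c M F)"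
  using assms wf_emit[OF assms(3)] wf_nest[of "[p..<p + c]" "p + c" \<Sigma>]
  by (simp add: subset_eq reduction_cmd_def write_marks_def make_counters_def extend_def on_def wf_seqs wf_For wf_rewind wf_nest
      write_graph_def write_order_def write_weights_def write_matrix_def over_cells_def over_cells'_def)

section \<open>Polynomial bounds\<close>

definition poly_bounded :: "(nat \<Rightarrow> nat) \<Rightarrow> bool" where
  "poly_bounded f \<longleftrightarrow> (\<exists>p :: nat poly. \<forall>n. f n \<le> poly p n)"

lemma poly_bounded_const: "poly_bounded (\<lambda>_. a)"
  unfolding poly_bounded_def by (rule exI[of _ "[:a:]"]) simp

lemma poly_bounded_id: "poly_bounded (\<lambda>n. n)"
  unfolding poly_bounded_def by (rule exI[of _ "[:0, 1:]"]) simp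

lemma poly_bounded_add: "poly_bounded f \<Longrightarrow> poly_bounded g \<Longrightarrow> poly_bounded (\<lambda>n. f n + g n)"
  unfolding poly_bounded_def by (metis add_mono poly_add)

lemma poly_bounded_mult: "poly_bounded f \<Longrightarrow> poly_bounded g \<Longrightarrow> poly_bounded (\<lambda>n. f n * g n)"
  unfolding poly_bounded_def by (metis mult_le_mono poly_mult)

lemma poly_bounded_power: "poly_bounded f \<Longrightarrow> poly_bounded (\<lambda>n. f n ^ c)"
  by (induction c) (simp_all add: poly_bounded_const poly_bounded_mult)

lemma poly_nat_mono: "m \<le> n \<Longrightarrow> poly (p :: nat poly) m \<le> poly p n"
  by (induction p) (auto intro: add_mono mult_le_mono)

text \<open>Coefficients are natural numbers, so polynomials are monotone, and a bound on the
  argument can be substituted.\<close>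

lemma poly_bounded_poly: "poly_bounded f \<Longrightarrow> poly_bounded (\<lambda>n. poly q (f n))"
  unfolding poly_bounded_def using poly_nat_mono[of _ _ q] by (metis poly_pcompose)

lemmas poly_bounded_intros = poly_bounded_const poly_bounded_id poly_bounded_add poly_bounded_mult
  poly_bounded_power poly_bounded_poly

lemma poly_bounded_nest_time: "poly_bounded f \<Longrightarrow> poly_bounded (\<lambda>n. nest_time (f n) d)"
  by (induction d) (auto intro!: poly_bounded_intros)

lemma poly_bounded_cells_time: "poly_bounded f \<Longrightarrow> poly_bounded g \<Longrightarrow> poly_bounded (\<lambda>n. cells_time (f n) (g n))"
  unfolding cells_time_def by (intro poly_bounded_intros)

lemma poly_bounded_write_time: "poly_bounded f \<Longrightarrow> poly_bounded (\<lambda>n. write_time m (f n))"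
  unfolding write_time_def by (intro poly_bounded_intros poly_bounded_cells_time)

lemma poly_bounded_reduction_time: "poly_bounded g \<Longrightarrow> poly_bounded (\<lambda>n. reduction_time b c m n (g n))"
  unfolding reduction_time_def by (intro poly_bounded_intros poly_bounded_nest_time poly_bounded_write_time)

text \<open>Brings the time bound into the shape that nested loops can count. It has to be strict,
  since a computation of \<open>m\<close> steps needs the row \<open>m\<close> below
  \<open>T\<close>.\<close>

lemma poly_less_power: "\<exists>b c. c \<ge> 1 \<and> (\<forall>n. poly (p :: nat poly) n < (n + b) ^ c)"
proof (induction p)
  case 0
  show ?case by (rule exI[of _ 1], rule exI[of _ 1]) simp
next
  case (pCons a p)
  then obtain b c where bc: "c \<ge> 1" "\<And>n. poly p n < (n + b) ^ c" by blast
  \<comment> \<open>Splitting one factor of the new power as \<open>n + (b + a + 1)\<close>, the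
    first part absorbs \<open>n * poly p n\<close> and the second exceeds \<open>a\<close>.\<close>
  have "poly (pCons a p) n < (n + (b + a + 1)) ^ Suc c" for n
  proof -
    let ?B = "n + (b + a + 1)"
    have "(n + b) ^ c \<le> ?B ^ c" by (intro power_mono) auto
    then have "poly p n \<le> ?B ^ c" using bc(2)[of n] by simp
    then have "n * poly p n \<le> n * ?B ^ c" by simp
    moreover have "a < (b + a + 1) * ?B ^ c"
    proof -
      have "(b + a + 1) * 1 \<le> (b + a + 1) * ?B ^ c" by (intro mult_le_mono2) simp
      then show ?thesis by simp
    qed
    ultimately have "a + n * poly p n < n * ?B ^ c + (b + a + 1) * ?B ^ c" by linarith
    then show ?thesis by (simp add: algebra_simps)
  qed
  then show ?case by (intro exI[of _ "b + a + 1"] exI[of _ "Suc c"]) simp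
qed

section \<open>Correctness and length of the instances\<close>

lemma weight_cong: "S \<subseteq> V \<Longrightarrow> (\<And>v. v \<in> V \<Longrightarrow> w v = w' v) \<Longrightarrow> weight w S = weight w' S"
  unfolding weight_def by (rule sum.cong) auto

text \<open>A code determines the weights of the vertices but not the values of \<open>w\<close>
  elsewhere.\<close>

lemma has_unique_mwis_cong:
  assumes "\<And>v. v \<in> V \<Longrightarrow> w v = w' v"
  shows "has_unique_mwis V E w = has_unique_mwis V E w'"
proof -
  have eq: "weight w S = weight w' S" if "independent_set V E S" for S
    using weight_cong assms that by (auto simp: independent_set_def)
  then have "weight w ` {S. independent_set V E S} = weight w' ` {S. independent_set V E S}"
    by (intro image_cong) auto
  then have "max_independent_weight V E w = max_independent_weight V E w'"
    unfolding max_independent_weight_def by simp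
  then show ?thesis using eq unfolding has_unique_mwis_def by metis
qed

lemma encode_graph_in_UI2:
  assumes "simple_graph {..<n} E"
  shows "encode_graph n E w \<in> UI2 \<longleftrightarrow> has_unique_mwis {..<n} E w"
proof
  assume "encode_graph n E w \<in> UI2"
  then obtain n' E' w' where e: "encode_graph n E w = encode_graph n' E' w'" "simple_graph {..<n'} E'"
    "has_unique_mwis {..<n'} E' w'" unfolding UI2_def by blast
  from encode_graph_inj[OF e(1) assms e(2)] e(3) show "has_unique_mwis {..<n} E w"
    using has_unique_mwis_cong[of "{..<n}" w w' E] by auto
qed (use assms in \<open>auto simp: UI2_def\<close>)

lemma length_concat_le: "(\<And>v. v \<in> set vs \<Longrightarrow> length (g v) \<le> a) \<Longrightarrow> length (concat (map g vs)) \<le> a * length vs"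
  by (induction vs) (auto intro: add_mono)

text \<open>\<open>n + 1\<close> bits for the order, at most three for each weight,
  \<open>n * n\<close> for the matrix. This is the length in which the running time of
  \<open>A\<close> is measured.\<close>

lemma length_encode_graph_le:
  assumes "\<And>v. w v \<le> 1"
  shows "length (encode_graph n E w) \<le> n + 1 + 3 * n + n * n"
proof -
  have "length (concat (map (\<lambda>v. encode_nat (w v)) [0..<n])) \<le> 3 * length [0..<n]"
    using length_encode_nat_le[OF assms] by (intro length_concat_le)
  then show ?thesis by (simp add: encode_graph_def)
qed

lemma tableau_weight_le: "tableau_weight M F x T v \<le> 1"
  unfolding tableau_weight_def Let_def by (cases "F ! (v mod length F)") auto

text \<open>\<open>F\<close>, \<open>b\<close> and \<open>c\<close> are determined by
  \<open>M\<close> alone, so a single program computes \<open>f\<close> for all inputs. As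
  \<open>f x\<close> is in \<open>UI2\<close> iff \<open>M\<close> rejects \<open>x\<close>,
  negating \<open>A\<close> on \<open>f x\<close> decides \<open>L\<close>.\<close>

lemma NP_subset_P_if_UI2_in_P:
  assumes "UI2 \<in> class_P"
  shows "class_NP \<subseteq> class_P"
proof
  fix L assume "L \<in> class_NP"
  then obtain M and p :: "nat poly" where M: "wf_machine M" "decides_in_time M (poly p) L"
    unfolding class_NP_def by blast
  obtain A and q :: "nat poly" where A: "wf_machine A" "deterministic A" "decides_in_time A (poly q) UI2"
    using assms unfolding class_P_def by blast
  obtain F where F: "set F = insert None (Some ` cells M)" "distinct F"
    using finite_distinct_list[of "insert None (Some ` cells M)"] finite_cells[OF M(1)] by auto
  obtain b c where bc: "c \<ge> 1" "\<And>n. poly p n < (n + b) ^ c"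
    using poly_less_power by blast
  define T where "T n = (n + b) ^ c" for n
  define N where "N n = 2 * T n * (2 * T n) * length F" for n
  define f where "f x = encode_graph (N (length x)) (tableau_edges (tapes M) F (2 * T (length x)))
      (tableau_weight M F x (T (length x)))" for x
  define len where "len n = N n + 1 + 3 * N n + N n * N n" for n
  have len: "length (f x) \<le> len (length x)" for x
    unfolding f_def len_def by (rule length_encode_graph_le) (rule tableau_weight_le)
  have red: "x \<in> L \<longleftrightarrow> f x \<notin> UI2" for x
  proof -
    let ?T = "T (length x)"
    have T: "poly p (length x) < ?T" using bc(2) by (simp add: T_def)
    then have "?T \<ge> 1" by simp
    have "f x \<in> UI2 \<longleftrightarrow> \<not> (\<exists>t. tableau M x ?T t)"
      unfolding f_def N_def encode_graph_in_UI2[OF simple_tableau_graph] tableau_graph_correct[OF \<open>?T \<ge> 1\<close> F] ..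
    moreover have "(\<exists>t. tableau M x ?T t) \<longleftrightarrow> accepts M x"
      using tableau_accepts[OF M(1) \<open>?T \<ge> 1\<close>] accepts_tableau[OF M _ T] by blast
    moreover have "x \<in> L \<longleftrightarrow> accepts M x" using M(2) by (simp add: decides_in_time_def)
    ultimately show ?thesis by simp
  qed
  define time where "time n = reduction_time b c (length F) n (len n) + poly q (len n) + 2" for n
  have "poly_bounded time"
    unfolding time_def len_def N_def T_def by (intro poly_bounded_intros poly_bounded_reduction_time)
  then obtain r :: "nat poly" where r: "\<And>n. time n \<le> poly r n" unfolding poly_bounded_def by blast
  \<comment> \<open>Tapes 0 to 9 serve the writing of the graph, those from 10 on belong to
    \<open>A\<close>, the first of them taking the output, and the counters follow from
    \<open>?p\<close> on.\<close>
  let ?p = "10 + tapes A" and ?\<Sigma> = "machine_symbols A \<union> {Aux 0, Aux 1, Aux 2}"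
  have tA: "tapes A \<ge> 1" using A(1) by (simp add: wf_machine_def)
  have "\<exists>N. wf_machine N \<and> deterministic N \<and> decides_in_time N (poly r) L"
  proof (rule machine_of_reduction[OF A, where p = 10 and k = "?p + c" and \<Sigma> = ?\<Sigma> and f = f
        and b = "\<lambda>x. reduction_time b c (length F) (length x) (length (f x))"])
    show "finite ?\<Sigma>" using finite_machine_symbols[OF A(1)] by simp
    show "wf_cmd (?p + c) ?\<Sigma> (reduction_cmd ?p b c M F)"
      by (rule wf_reduction_cmd) (use tA bc(1) in \<open>auto simp: machine_symbols_def\<close>)
    show "\<exists>\<sigma>. runs (reduction_cmd ?p b c M F) (init_store x) (reduction_time b c (length F) (length x) (length (f x))) \<sigma> \<and>
        map \<sigma> [10..<10 + tapes A] = snd (initial A (f x))" for x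
    proof -
      obtain \<sigma> where \<sigma>: "runs (reduction_cmd ?p b c M F) (init_store x) (reduction_time b c (length F) (length x) (length (f x))) \<sigma>"
        "\<sigma> 10 = input_tape (f x)" "\<forall>n>10. n < ?p \<longrightarrow> \<sigma> n = blank_tape"
        using runs_reduction[of ?p c "T (length x)" x b "f x" F M] tA bc(1) by (auto simp: T_def f_def N_def)
      have "map \<sigma> [10..<10 + tapes A] = snd (initial A (f x))"
        using \<sigma>(2,3) tA by (intro nth_equalityI) (auto simp: initial_def nth_Cons')
      with \<sigma>(1) show ?thesis by blast
    qed
    show "reduction_time b c (length F) (length x) (length (f x)) + poly q (length (f x)) + 2 \<le> poly r (length x)" for x
    proof -
      have "reduction_time b c (length F) (length x) (length (f x)) \<le> reduction_time b c (length F) (length x) (len (length x))"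
        using len[of x] by (simp add: reduction_time_def)
      moreover have "poly q (length (f x)) \<le> poly q (len (length x))" using len by (rule poly_nat_mono)
      ultimately show ?thesis using r[of "length x"] unfolding time_def by linarith
    qed
  qed (use red in auto)
  then show "L \<in> class_P" unfolding class_P_def by blast
qed

theorem theorem3p2:
  assumes "UI2 \<in> class_P"
  shows "class_P = class_NP"
  using NP_subset_P_if_UI2_in_P[OF assms] by (auto simp: class_P_def class_NP_def)

end
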